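(* Let $q$ range over prime powers with $q\equiv 3\pmod 4$, $q\to\infty$, and let $\mathcal{E}=\mathcal{E}_q\subseteq\mathbb{F}_q^2$ be sets such that $q^{8/7}=o(|\mathcal{E}|)$, i.e. $q^{8/7}/|\mathcal{E}|\to 0$ as $q\to\infty$. Then \[|\Delta_{\mathbb{F}_q}(\mathcal{E})+\Delta_{\mathbb{F}_q}(\mathcal{E})|=(1-o(1))q,\] i.e. $|\Delta_{\mathbb{F}_q}(\mathcal{E})+\Delta_{\mathbb{F}_q}(\mathcal{E})|/q\to 1$ as $q\to\infty$.
   Context: $\mathbb{F}_q$ is the finite field of order $q$. For $\mathbf{x},\mathbf{y}\in\mathbb{F}_q^2$ put $||\mathbf{x}-\mathbf{y}||=(x_1-y_1)^2+(x_2-y_2)^2\in\mathbb{F}_q$. For $\mathcal{E}\subseteq\mathbb{F}_q^2$, the distance set is $\Delta_{\mathbb{F}_q}(\mathcal{E})=\{||\mathbf{x}-\mathbf{y}||\colon \mathbf{x},\mathbf{y}\in\mathcal{E}\}\subseteq\mathbb{F}_q$, and $A+A=\{a+b\colon a,b\in A\}$ for $A\subseteq\mathbb{F}_q$. The notation $X=o(Y)$ means $X/Y\to 0$ as $q\to\infty$, where $X,Y$ are viewed as functions of $q$. *)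

theory Defs
  imports
    Complex_Main
    "HOL-Algebra.AbelCoset"
    "HOL-Algebra.Ring"
    "HOL-Library.Landau_Symbols"
    "HOL-Number_Theory.Prime_Powers"
begin

definition sq_dist :: "('a, 'm) ring_scheme \<Rightarrow> 'a \<times> 'a \<Rightarrow> 'a \<times> 'a \<Rightarrow> 'a" where
  "sq_dist R x y =
     ((fst x \<ominus>\<^bsub>R\<^esub> fst y) [^]\<^bsub>R\<^esub> (2::nat)) \<oplus>\<^bsub>R\<^esub> ((snd x \<ominus>\<^bsub>R\<^esub> snd y) [^]\<^bsub>R\<^esub> (2::nat))"

definition distance_set :: "('a, 'm) ring_scheme \<Rightarrow> ('a \<times> 'a) set \<Rightarrow> 'a set" where
  "distance_set R E = {sq_dist R x y | x y. x \<in> E \<and> y \<in> E}"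

definition prime_powers_3_mod_4 :: "nat set" where
  "prime_powers_3_mod_4 = {q. primepow q \<and> q mod 4 = 3}"

text \<open>The limit in which \<open>q\<close> tends to infinity through the prime powers congruent to 3 modulo 4.
  This set is infinite (it contains the odd powers of 3), so the filter is nontrivial.\<close>

definition q_to_infinity :: "nat filter" where
  "q_to_infinity = inf at_top (principal prime_powers_3_mod_4)"

end

(*
  Write nu(t) for the sum of chi (t * ||x - y||) over x, y in E, where chi is a nontrivial additive
  character of the field. If b is not a sum of two distances, then the sum of nu(s)^2 * chi (- s * b)
  over s vanishes, so its part with s nonzero is - |E|^4. By Plancherel in b, the number of such b
  is at most q |E|^(-8) times the fourth moment of nu over nonzero arguments.

  Completing the square turns nu(t), up to a Gauss sum of modulus q, into the transform along
  xi |-> ||xi|| of the weight |E^(xi)|^2, where E^ is the Fourier transform of the indicator of E.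
  Plancherel then gives |nu(t)| <= q |E|, and bounds the second moment of nu by the masses of
  |E^|^2 on the circles. As -1 is not a square, a point other than the origin is a sum of two
  points of a given circle in at most one way up to order. Hence the extension operator of a
  circle is bounded from L^2 to L^4, and by duality each circle has mass at most
  sqrt 3 * q |E|^(3/2). Altogether at most sqrt 3 * q^5 |E|^(-7/2) elements are missing.
*)
theory Submission
  imports Defs "HOL-Analysis.Convex" "HOL-Algebra.Multiplicative_Group"
begin

section \<open>Characters of finite abelian groups\<close>

lemma (in comm_group) nontrivial_character_exists:
  assumes fin: "finite (carrier G)" and nt: "carrier G \<noteq> {\<one>}"
  shows "\<exists>\<chi> :: 'a \<Rightarrow> complex. (\<forall>x\<in>carrier G. \<forall>y\<in>carrier G. \<chi> (x \<otimes> y) = \<chi> x * \<chi> y) \<and>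
    (\<forall>x\<in>carrier G. norm (\<chi> x) = 1) \<and> (\<exists>x\<in>carrier G. \<chi> x \<noteq> 1)"
proof -
  txt \<open>The character is trivial on a maximal proper subgroup \<open>H\<close>, whose quotient is cyclic.\<close>
  let ?S = "{H. subgroup H G \<and> H \<noteq> carrier G}"
  have "finite ?S"
    using fin by (rule_tac finite_subset[of _ "Pow (carrier G)"]) (auto dest: subgroup.subset)
  moreover have "{\<one>} \<in> ?S" using nt triv_subgroup by auto
  ultimately obtain H where H: "subgroup H G" "H \<noteq> carrier G"
    and H_max: "\<And>K. subgroup K G \<Longrightarrow> K \<noteq> carrier G \<Longrightarrow> H \<subseteq> K \<Longrightarrow> H = K"
    using finite_has_maximal[of ?S] by blast
  interpret H: subgroup H G by (rule H)
  obtain x where x: "x \<in> carrier G" "x \<notin> H" using H H.subset by blast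
  \<comment> \<open>\<open>K\<close> is the subgroup generated by \<open>H\<close> and
    \<open>x\<close>. By maximality of \<open>H\<close> it is the whole group, so the class of
    \<open>x\<close> generates the quotient by \<open>H\<close>.\<close>
  define K where "K = {h \<otimes> x [^] (n::int) | h n. h \<in> H}"
  have K_mult: "(h \<otimes> x [^] (n::int)) \<otimes> (h' \<otimes> x [^] (n'::int)) = (h \<otimes> h') \<otimes> x [^] (n + n')"
    if "h \<in> H" "h' \<in> H" for h h' n n'
    using that x by (simp add: int_pow_mult m_ac)
  have "subgroup K G"
  proof (rule subgroupI)
    show "K \<subseteq> carrier G" unfolding K_def using x by auto
    show "K \<noteq> {}" unfolding K_def using H.one_closed by blast
  next
    fix a assume "a \<in> K"
    then obtain h n where hn: "h \<in> H" "a = h \<otimes> x [^] (n::int)" unfolding K_def by blast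
    then have "inv a = inv h \<otimes> x [^] (-n)" using x by (simp add: inv_mult int_pow_neg)
    then show "inv a \<in> K" unfolding K_def using hn H.m_inv_closed by blast
  next
    fix a b assume "a \<in> K" "b \<in> K"
    then show "a \<otimes> b \<in> K" unfolding K_def using K_mult H.m_closed by (smt (verit, best) mem_Collect_eq)
  qed
  moreover have "H \<subseteq> K"
  proof
    fix h assume "h \<in> H"
    then have "h = h \<otimes> x [^] (0::int)" by simp
    then show "h \<in> K" unfolding K_def using \<open>h \<in> H\<close> by blast
  qed
  moreover have "x \<in> K"
  proof -
    have "x = \<one> \<otimes> x [^] (1::int)" using x by (simp add: int_pow_1)
    then show ?thesis unfolding K_def using H.one_closed by blast
  qed
  ultimately have K: "K = carrier G" using H_max x by blast
  \<comment> \<open>\<open>m\<close> is the order of \<open>x\<close> modulo \<open>H\<close>; the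
    order of the group supplies a positive exponent, so a least one exists.\<close>
  define m where "m = (LEAST m::nat. 0 < m \<and> x [^] m \<in> H)"
  have "0 < order G \<and> x [^] order G \<in> H"
    using fin x pow_order_eq_1 order_gt_0_iff_finite by auto
  then have m: "0 < m" "x [^] m \<in> H"
    unfolding m_def by (metis (mono_tags, lifting) LeastI)+
  have m_least: "\<not> (0 < k \<and> x [^] k \<in> H)" if "k < m" for k :: nat
    using that not_less_Least unfolding m_def by blast
  \<comment> \<open>Division with remainder: the remainder is again an exponent taking
    \<open>x\<close> into \<open>H\<close>, and it lies below the least positive one.\<close>
  have m_dvd: "int m dvd n" if n: "x [^] n \<in> H" for n :: int
  proof -
    define r where "r = n mod int m"
    have r: "0 \<le> r" "r < int m" unfolding r_def using m by auto
    have "x [^] r = x [^] n \<otimes> inv ((x [^] int m) [^] (n div int m))"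
      using x by (simp add: int_pow_pow int_pow_diff[symmetric] r_def minus_mult_div_eq_mod)
    moreover have "x [^] int m \<in> H" using m by (simp add: int_pow_int)
    then have "(x [^] int m) [^] (n div int m) \<in> H"
      using H by (simp add: subgroup_int_pow_closed)
    ultimately have "x [^] r \<in> H" using n by simp
    then have "x [^] nat r \<in> H" using r by (metis int_pow_int int_nat_eq)
    then have "nat r = 0" using m_least[of "nat r"] r by linarith
    then show ?thesis using r unfolding r_def by auto
  qed
  \<comment> \<open>A character of the integers with kernel the multiples of \<open>m\<close>, to be
    transported to the cyclic quotient.\<close>
  define e where "e n = cis (2 * pi * real_of_int n / real m)" for n
  have e_add: "e (a + b) = e a * e b" for a b
    unfolding e_def by (simp add: cis_mult ring_distribs add_divide_distrib)
  have e_dvd: "e a = 1" if "int m dvd a" for a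
  proof -
    obtain k where "a = int m * k" using \<open>int m dvd a\<close> by auto
    then have "2 * pi * real_of_int a / real m = 2 * pi * real_of_int k" using m by simp
    then show ?thesis unfolding e_def by (metis Ints_of_int cis_multiple_2pi)
  qed
  have e_cong: "e a = e b" if "int m dvd a - b" for a b
    using e_add[of "a - b" b] e_dvd[OF that] by simp
  \<comment> \<open>The discrete logarithm to base \<open>x\<close> modulo \<open>H\<close>. The
    chosen exponent is unique only modulo \<open>m\<close>, which \<open>e\<close> does not
    see.\<close>
  define \<nu> where "\<nu> g = (SOME n::int. \<exists>h\<in>H. g = h \<otimes> x [^] n)" for g
  have \<nu>: "\<exists>h\<in>H. g = h \<otimes> x [^] \<nu> g" if "g \<in> carrier G" for g
  proof -
    have "\<exists>n::int. \<exists>h\<in>H. g = h \<otimes> x [^] n" using that K unfolding K_def by blast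
    then show ?thesis unfolding \<nu>_def by (rule someI_ex)
  qed
  have uniq: "int m dvd n - n'" if "h \<otimes> x [^] n = h' \<otimes> x [^] n'" "h \<in> H" "h' \<in> H" for h h' and n n' :: int
  proof -
    have "x [^] (n - n') = inv h \<otimes> (h \<otimes> x [^] n) \<otimes> inv (x [^] n')"
      using x that(2) by (simp add: int_pow_diff m_assoc[symmetric])
    also have "\<dots> = inv h \<otimes> h'"
      unfolding that(1) using x that(2,3) by (simp add: m_assoc)
    finally show ?thesis using that by (intro m_dvd) auto
  qed
  show ?thesis
  proof (intro exI[of _ "\<lambda>g. e (\<nu> g)"] conjI ballI)
    fix g g' assume g: "g \<in> carrier G" "g' \<in> carrier G"
    obtain h where h: "h \<in> H" "g = h \<otimes> x [^] \<nu> g" using \<nu> g by blast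
    obtain h' where h': "h' \<in> H" "g' = h' \<otimes> x [^] \<nu> g'" using \<nu> g by blast
    obtain h'' where h'': "h'' \<in> H" "g \<otimes> g' = h'' \<otimes> x [^] \<nu> (g \<otimes> g')" using \<nu> g by blast
    have "g \<otimes> g' = (h \<otimes> h') \<otimes> x [^] (\<nu> g + \<nu> g')" using K_mult[of h h'] h h' by metis
    then have "int m dvd \<nu> (g \<otimes> g') - (\<nu> g + \<nu> g')"
      using h'' h h' by (intro uniq[of h'' _ "h \<otimes> h'"]) auto
    then show "e (\<nu> (g \<otimes> g')) = e (\<nu> g) * e (\<nu> g')" using e_cong e_add by metis
  next
    fix g assume "g \<in> carrier G"
    show "norm (e (\<nu> g)) = 1" unfolding e_def by simp
  next
    obtain h where h: "h \<in> H" "x = h \<otimes> x [^] \<nu> x" using \<nu> x by blast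
    have "int m dvd 1 - \<nu> x"
      using h x by (intro uniq[of \<one> _ h]) (auto simp: int_pow_1)
    then have "e (\<nu> x) = e 1" using e_cong by metis
    \<comment> \<open>Were \<open>e 1\<close> equal to 1, then \<open>m\<close> would be 1 and
      \<open>x\<close> would lie in \<open>H\<close>.\<close>
    moreover have "e 1 \<noteq> 1"
    proof
      assume "e 1 = 1"
      then have "cos (2 * pi / real m) = 1" unfolding e_def by (metis Re_complex_of_real cis.simps(1) mult.right_neutral of_int_1 of_real_1)
      then obtain k :: int where "2 * pi / real m = real_of_int k * 2 * pi" using cos_one_2pi_int by auto
      then have "real_of_int (k * int m) = 1" using m by (simp add: field_simps)
      then have "k * int m = 1" using of_int_eq_1_iff by blast
      then have "m = 1" using m by (simp add: zmult_eq_1_iff)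
      then show False using m x by simp
    qed
    ultimately have "e (\<nu> x) \<noteq> 1" by simp
    then show "\<exists>g\<in>carrier G. e (\<nu> g) \<noteq> 1" using x(1) by (rule bexI)
  qed
qed

section \<open>The plane over a commutative ring\<close>

context cring
begin

abbreviation plane :: "('a \<times> 'a) set" where
  "plane \<equiv> carrier R \<times> carrier R"

definition dot :: "'a \<times> 'a \<Rightarrow> 'a \<times> 'a \<Rightarrow> 'a" (infixl "\<star>" 70) where
  "x \<star> y = fst x \<otimes> fst y \<oplus> snd x \<otimes> snd y"

definition vadd :: "'a \<times> 'a \<Rightarrow> 'a \<times> 'a \<Rightarrow> 'a \<times> 'a" (infixl "\<boxplus>" 65) where
  "x \<boxplus> y = (fst x \<oplus> fst y, snd x \<oplus> snd y)"

definition vsub :: "'a \<times> 'a \<Rightarrow> 'a \<times> 'a \<Rightarrow> 'a \<times> 'a" (infixl "\<boxminus>" 65) where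
  "x \<boxminus> y = (fst x \<ominus> fst y, snd x \<ominus> snd y)"

definition scale :: "'a \<Rightarrow> 'a \<times> 'a \<Rightarrow> 'a \<times> 'a" where
  "scale a x = (a \<otimes> fst x, a \<otimes> snd x)"

lemma vec_closed [simp, intro]:
  assumes "x \<in> plane" "y \<in> plane"
  shows "x \<star> y \<in> carrier R" "x \<boxplus> y \<in> plane" "x \<boxminus> y \<in> plane"
  using assms by (auto simp: dot_def vadd_def vsub_def)

lemma scale_closed [simp, intro]: "a \<in> carrier R \<Longrightarrow> x \<in> plane \<Longrightarrow> scale a x \<in> plane"
  by (auto simp: scale_def)

lemma sq_dist_eq:
  assumes "x \<in> plane" "y \<in> plane"
  shows "sq_dist R x y = (x \<boxminus> y) \<star> (x \<boxminus> y)"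
  using assms by (auto simp: sq_dist_def dot_def vsub_def numeral_2_eq_2)

lemma dot_vadd_left:
  "x \<in> plane \<Longrightarrow> y \<in> plane \<Longrightarrow> z \<in> plane \<Longrightarrow> (x \<boxplus> y) \<star> z = x \<star> z \<oplus> y \<star> z"
  unfolding dot_def vadd_def by clarsimp algebra

lemma dot_vsub_right:
  "x \<in> plane \<Longrightarrow> y \<in> plane \<Longrightarrow> z \<in> plane \<Longrightarrow> z \<star> (x \<boxminus> y) = z \<star> x \<ominus> z \<star> y"
  unfolding dot_def vsub_def by clarsimp algebra

lemma dot_commute: "x \<in> plane \<Longrightarrow> y \<in> plane \<Longrightarrow> x \<star> y = y \<star> x"
  by (auto simp: dot_def m_comm)

lemma vsub_eq_zero_iff:
  "x \<in> plane \<Longrightarrow> y \<in> plane \<Longrightarrow> x \<boxminus> y = (\<zero>, \<zero>) \<longleftrightarrow> x = y"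
  by (auto simp: vsub_def prod_eq_iff r_right_minus_eq)

text \<open>Up to scaling, the product with \<open>x\<close> and the determinant with
  \<open>x\<close> are the coordinates of a vector in the orthogonal frame given by \<open>x\<close>
  and its quarter turn.\<close>

lemma lagrange_identity:
  assumes "x \<in> plane" "y \<in> plane" "z \<in> plane"
  shows "(x \<star> x) \<otimes> (y \<star> z) = (x \<star> y) \<otimes> (x \<star> z) \<oplus>
    (fst x \<otimes> snd y \<ominus> snd x \<otimes> fst y) \<otimes> (fst x \<otimes> snd z \<ominus> snd x \<otimes> fst z)"
  using assms unfolding dot_def by clarsimp algebra

text \<open>When all four points lie on one circle, both right-hand sides vanish, so equality of
  sums becomes orthogonality. Doubled left-hand sides avoid dividing by two. Both identities hold
  coordinate by coordinate.\<close>

lemma circle_identities: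
  assumes "x \<in> plane" "y \<in> plane" "z \<in> plane" "w \<in> plane" "x \<boxplus> y = z \<boxplus> w"
  shows "(x \<boxplus> y) \<star> (z \<boxminus> x) \<oplus> (x \<boxplus> y) \<star> (z \<boxminus> x) = (y \<star> y \<ominus> x \<star> x) \<ominus> (w \<star> w \<ominus> z \<star> z)"
    and "(z \<boxminus> x) \<star> (z \<boxminus> y) \<oplus> (z \<boxminus> x) \<star> (z \<boxminus> y) = z \<star> z \<oplus> w \<star> w \<ominus> (x \<star> x \<oplus> y \<star> y)"
proof -
  have one_dim: "(a \<oplus> b) \<otimes> (c \<ominus> a) \<oplus> (a \<oplus> b) \<otimes> (c \<ominus> a) = (b \<otimes> b \<ominus> a \<otimes> a) \<ominus> (d \<otimes> d \<ominus> c \<otimes> c)"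
      "(c \<ominus> a) \<otimes> (c \<ominus> b) \<oplus> (c \<ominus> a) \<otimes> (c \<ominus> b) = c \<otimes> c \<oplus> d \<otimes> d \<ominus> (a \<otimes> a \<oplus> b \<otimes> b)"
    if mem: "a \<in> carrier R" "b \<in> carrier R" "c \<in> carrier R" "d \<in> carrier R" and s: "a \<oplus> b = c \<oplus> d" for a b c d
  proof -
    \<comment> \<open>Eliminating \<open>d\<close> turns the constrained identities into polynomial
      identities in three free variables.\<close>
    have "d = (c \<oplus> d) \<ominus> c" using mem by algebra
    then have d: "d = a \<oplus> b \<ominus> c" unfolding s .
    show "(a \<oplus> b) \<otimes> (c \<ominus> a) \<oplus> (a \<oplus> b) \<otimes> (c \<ominus> a) = (b \<otimes> b \<ominus> a \<otimes> a) \<ominus> (d \<otimes> d \<ominus> c \<otimes> c)"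
      unfolding d using mem(1-3) by algebra
    show "(c \<ominus> a) \<otimes> (c \<ominus> b) \<oplus> (c \<ominus> a) \<otimes> (c \<ominus> b) = c \<otimes> c \<oplus> d \<otimes> d \<ominus> (a \<otimes> a \<oplus> b \<otimes> b)"
      unfolding d using mem(1-3) by algebra
  qed
  have mem: "fst x \<in> carrier R" "snd x \<in> carrier R" "fst y \<in> carrier R" "snd y \<in> carrier R"
    "fst z \<in> carrier R" "snd z \<in> carrier R" "fst w \<in> carrier R" "snd w \<in> carrier R"
    using assms(1-4) by auto
  have s: "fst x \<oplus> fst y = fst z \<oplus> fst w" "snd x \<oplus> snd y = snd z \<oplus> snd w"
    using assms(5) by (auto simp: vadd_def)
  have double_sum: "(a \<oplus> b) \<oplus> (a \<oplus> b) = (a \<oplus> a) \<oplus> (b \<oplus> b)"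
    if "a \<in> carrier R" "b \<in> carrier R" for a b
    using that by algebra
  have regroup1: "((a \<ominus> b) \<ominus> (c \<ominus> d)) \<oplus> ((a' \<ominus> b') \<ominus> (c' \<ominus> d')) =
      ((a \<oplus> a') \<ominus> (b \<oplus> b')) \<ominus> ((c \<oplus> c') \<ominus> (d \<oplus> d'))"
    if "a \<in> carrier R" "b \<in> carrier R" "c \<in> carrier R" "d \<in> carrier R"
      "a' \<in> carrier R" "b' \<in> carrier R" "c' \<in> carrier R" "d' \<in> carrier R" for a b c d a' b' c' d'
    using that by algebra
  have regroup2: "(a \<oplus> b \<ominus> (c \<oplus> d)) \<oplus> (a' \<oplus> b' \<ominus> (c' \<oplus> d')) =
      (a \<oplus> a') \<oplus> (b \<oplus> b') \<ominus> ((c \<oplus> c') \<oplus> (d \<oplus> d'))"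
    if "a \<in> carrier R" "b \<in> carrier R" "c \<in> carrier R" "d \<in> carrier R"
      "a' \<in> carrier R" "b' \<in> carrier R" "c' \<in> carrier R" "d' \<in> carrier R" for a b c d a' b' c' d'
    using that by algebra
  show "(x \<boxplus> y) \<star> (z \<boxminus> x) \<oplus> (x \<boxplus> y) \<star> (z \<boxminus> x) = (y \<star> y \<ominus> x \<star> x) \<ominus> (w \<star> w \<ominus> z \<star> z)"
    unfolding dot_def vadd_def vsub_def fst_conv snd_conv
    by (subst double_sum, (use mem in simp_all)[2], subst one_dim(1)[OF mem(1,3,5,7) s(1)],
        subst one_dim(1)[OF mem(2,4,6,8) s(2)], rule regroup1) (use mem in simp_all)
  show "(z \<boxminus> x) \<star> (z \<boxminus> y) \<oplus> (z \<boxminus> x) \<star> (z \<boxminus> y) = z \<star> z \<oplus> w \<star> w \<ominus> (x \<star> x \<oplus> y \<star> y)"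
    unfolding dot_def vadd_def vsub_def fst_conv snd_conv
    by (subst double_sum, (use mem in simp_all)[2], subst one_dim(2)[OF mem(1,3,5,7) s(1)],
        subst one_dim(2)[OF mem(2,4,6,8) s(2)], rule regroup2) (use mem in simp_all)
qed

lemma vadd_commute: "x \<in> plane \<Longrightarrow> y \<in> plane \<Longrightarrow> x \<boxplus> y = y \<boxplus> x"
  by (auto simp: vadd_def a_comm)

lemma vadd_left_cancel: "x \<in> plane \<Longrightarrow> y \<in> plane \<Longrightarrow> z \<in> plane \<Longrightarrow> x \<boxplus> y = x \<boxplus> z \<longleftrightarrow> y = z"
  by (auto simp: vadd_def)

text \<open>The hypothesis says 4st = 1. Hence 2t = 1/(2s) is the shift that absorbs the linear
  term, and the remaining constant is 1/(4s) = t times the norm of \<open>v\<close>.\<close>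

lemma complete_square:
  assumes P: "x \<in> plane" "v \<in> plane" and s: "s \<in> carrier R" and t: "t \<in> carrier R"
    and inverse: "s \<otimes> ((t \<oplus> t) \<oplus> (t \<oplus> t)) = \<one>"
  shows "s \<otimes> (x \<star> x) \<oplus> x \<star> v =
    s \<otimes> ((x \<boxplus> scale (t \<oplus> t) v) \<star> (x \<boxplus> scale (t \<oplus> t) v)) \<ominus> t \<otimes> (v \<star> v)"
proof -
  have one_dim: "s \<otimes> ((a \<oplus> (t \<oplus> t) \<otimes> b) \<otimes> (a \<oplus> (t \<oplus> t) \<otimes> b)) = s \<otimes> (a \<otimes> a) \<oplus> a \<otimes> b \<oplus> t \<otimes> (b \<otimes> b)"
    if ab: "a \<in> carrier R" "b \<in> carrier R" for a b
  proof -
    define c where "c = t \<oplus> t"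
    have c: "c \<in> carrier R" unfolding c_def using t by simp
    \<comment> \<open>With c = 2t this reads 4t^2 = (4t)t, so the hypothesis reduces s c^2 to
      t.\<close>
    have "c \<otimes> c = (c \<oplus> c) \<otimes> t" unfolding c_def using t by algebra
    then have "s \<otimes> ((c \<otimes> c) \<otimes> (b \<otimes> b)) = (s \<otimes> (c \<oplus> c)) \<otimes> (t \<otimes> (b \<otimes> b))"
      using c s t ab by (simp add: m_assoc)
    moreover have "s \<otimes> ((a \<oplus> c \<otimes> b) \<otimes> (a \<oplus> c \<otimes> b)) =
        s \<otimes> (a \<otimes> a) \<oplus> (s \<otimes> (c \<oplus> c)) \<otimes> (a \<otimes> b) \<oplus> s \<otimes> ((c \<otimes> c) \<otimes> (b \<otimes> b))"
      using ab s c by algebra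
    ultimately have "s \<otimes> ((a \<oplus> c \<otimes> b) \<otimes> (a \<oplus> c \<otimes> b)) =
        s \<otimes> (a \<otimes> a) \<oplus> (s \<otimes> (c \<oplus> c)) \<otimes> (a \<otimes> b \<oplus> t \<otimes> (b \<otimes> b))"
      using ab s c t by (simp add: r_distr[of _ _ "s \<otimes> (c \<oplus> c)"] a_assoc)
    also have "\<dots> = s \<otimes> (a \<otimes> a) \<oplus> \<one> \<otimes> (a \<otimes> b \<oplus> t \<otimes> (b \<otimes> b))" unfolding c_def inverse ..
    finally show ?thesis unfolding c_def using ab t s by (simp add: a_assoc)
  qed
  have regroup: "(a \<oplus> b) \<oplus> (c \<oplus> d) = (a \<oplus> c \<oplus> e \<oplus> (b \<oplus> d \<oplus> f)) \<ominus> (e \<oplus> f)"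
    if "a \<in> carrier R" "b \<in> carrier R" "c \<in> carrier R" "d \<in> carrier R" "e \<in> carrier R" "f \<in> carrier R"
    for a b c d e f
    using that by algebra
  have mem: "fst x \<in> carrier R" "snd x \<in> carrier R" "fst v \<in> carrier R" "snd v \<in> carrier R"
    using P by auto
  have dist: "u \<otimes> (a \<oplus> b) = u \<otimes> a \<oplus> u \<otimes> b"
    if "u \<in> carrier R" "a \<in> carrier R" "b \<in> carrier R" for u a b
    using that by (simp add: r_distr)
  have expand: "s \<otimes> ((x \<boxplus> scale (t \<oplus> t) v) \<star> (x \<boxplus> scale (t \<oplus> t) v)) =
      (s \<otimes> (fst x \<otimes> fst x) \<oplus> fst x \<otimes> fst v \<oplus> t \<otimes> (fst v \<otimes> fst v)) \<oplus>
      (s \<otimes> (snd x \<otimes> snd x) \<oplus> snd x \<otimes> snd v \<oplus> t \<otimes> (snd v \<otimes> snd v))"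
    unfolding dot_def vadd_def scale_def fst_conv snd_conv
    by (subst dist, (use s t mem in simp_all)[3]) (simp only: one_dim mem)
  have "s \<otimes> (x \<star> x) = s \<otimes> (fst x \<otimes> fst x) \<oplus> s \<otimes> (snd x \<otimes> snd x)"
      "t \<otimes> (v \<star> v) = t \<otimes> (fst v \<otimes> fst v) \<oplus> t \<otimes> (snd v \<otimes> snd v)"
      "x \<star> v = fst x \<otimes> fst v \<oplus> snd x \<otimes> snd v"
    unfolding dot_def using mem s t by (simp_all add: dist)
  then show ?thesis unfolding expand
    by (simp only:) (rule regroup; use mem s t in simp)
qed

text \<open>The cross term is written as a product of \<open>y\<close> with a multiple of
  \<open>x\<close>, so that a character sum over \<open>y\<close> can be evaluated by
  orthogonality.\<close>

lemma norm_vadd_expand: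
  assumes "x \<in> plane" "y \<in> plane" "s \<in> carrier R"
  shows "s \<otimes> ((x \<boxplus> y) \<star> (x \<boxplus> y)) = s \<otimes> (x \<star> x) \<oplus> y \<star> scale (s \<oplus> s) x \<oplus> s \<otimes> (y \<star> y)"
proof -
  have one_dim: "s \<otimes> ((a \<oplus> b) \<otimes> (a \<oplus> b)) = s \<otimes> (a \<otimes> a) \<oplus> b \<otimes> ((s \<oplus> s) \<otimes> a) \<oplus> s \<otimes> (b \<otimes> b)"
    if "a \<in> carrier R" "b \<in> carrier R" for a b
    using that assms(3) by algebra
  have regroup: "(a \<oplus> b \<oplus> c) \<oplus> (a' \<oplus> b' \<oplus> c') = (a \<oplus> a') \<oplus> (b \<oplus> b') \<oplus> (c \<oplus> c')"
    if "a \<in> carrier R" "b \<in> carrier R" "c \<in> carrier R"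
      "a' \<in> carrier R" "b' \<in> carrier R" "c' \<in> carrier R" for a b c a' b' c'
    using that by algebra
  have mem: "fst x \<in> carrier R" "snd x \<in> carrier R" "fst y \<in> carrier R" "snd y \<in> carrier R"
    using assms by auto
  show ?thesis
    unfolding dot_def vadd_def scale_def fst_conv snd_conv
    using mem assms(3) by (simp add: r_distr[of _ _ s] one_dim regroup)
qed

end

section \<open>The anisotropic plane: odd characteristic, -1 not a square, and sums of points on a
  circle\<close>

locale anisotropic_plane = field R for R (structure) +
  assumes double_eq_zero: "a \<in> carrier R \<Longrightarrow> a \<oplus> a = \<zero> \<Longrightarrow> a = \<zero>"
    and anisotropic: "a \<in> carrier R \<Longrightarrow> b \<in> carrier R \<Longrightarrow> a \<otimes> a \<oplus> b \<otimes> b = \<zero> \<Longrightarrow> a = \<zero>"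
begin

lemma dot_self_eq_zero:
  assumes "x \<in> plane" "x \<star> x = \<zero>"
  shows "x = (\<zero>, \<zero>)"
proof -
  obtain a b where x: "x = (a, b)" by fastforce
  with assms have ab: "a \<in> carrier R" "b \<in> carrier R" "a \<otimes> a \<oplus> b \<otimes> b = \<zero>" "b \<otimes> b \<oplus> a \<otimes> a = \<zero>"
    by (auto simp: dot_def a_comm)
  then show ?thesis using anisotropic x by blast
qed

text \<open>Dimension count: if \<open>x\<close> is nonzero, the other two vectors lie on the line
  orthogonal to \<open>x\<close>. Being orthogonal to each other as well, one of them vanishes,
  since there are no isotropic vectors.\<close>

lemma mutually_orthogonal:
  assumes P: "x \<in> plane" "y \<in> plane" "z \<in> plane"
    and orth: "x \<star> y = \<zero>" "x \<star> z = \<zero>" "y \<star> z = \<zero>"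
  shows "x = (\<zero>, \<zero>) \<or> y = (\<zero>, \<zero>) \<or> z = (\<zero>, \<zero>)"
proof -
  define cr where "cr v = fst x \<otimes> snd v \<ominus> snd x \<otimes> fst v" for v
  have cr_in: "cr v \<in> carrier R" if "v \<in> plane" for v using that P unfolding cr_def by auto
  \<comment> \<open>Both coordinates of \<open>v\<close> in the frame of \<open>x\<close> vanish, so
    Lagrange's identity makes the norm of \<open>x\<close> times that of \<open>v\<close>
    zero.\<close>
  have trivial: "v = (\<zero>, \<zero>)" if "v \<in> plane" "x \<star> v = \<zero>" "cr v = \<zero>" "x \<noteq> (\<zero>, \<zero>)" for v
  proof -
    have "(x \<star> x) \<otimes> (v \<star> v) = \<zero>"
      using lagrange_identity[of x v v] P that unfolding cr_def by simp
    then have "x \<star> x = \<zero> \<or> v \<star> v = \<zero>"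
      using integral vec_closed(1)[OF P(1) P(1)] vec_closed(1)[OF that(1) that(1)] by blast
    then have "v \<star> v = \<zero>" using that(4) P(1) dot_self_eq_zero by blast
    then show ?thesis using that(1) dot_self_eq_zero by blast
  qed
  have "cr y \<otimes> cr z = \<zero>"
    using lagrange_identity[of x y z] P orth cr_in unfolding cr_def by simp
  then have "cr y = \<zero> \<or> cr z = \<zero>" using integral cr_in[OF P(2)] cr_in[OF P(3)] by blast
  then show ?thesis using trivial[OF P(2) orth(1)] trivial[OF P(3) orth(2)] by blast
qed

text \<open>The vectors \<open>x \<boxplus> y\<close>, \<open>z \<boxminus> x\<close> and
  \<open>z \<boxminus> y\<close> are mutually orthogonal, so one of them is zero; the three
  possibilities are the three cases.\<close>

lemma circle_sum_eq_cases:
  assumes P: "x \<in> plane" "y \<in> plane" "z \<in> plane" "w \<in> plane"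
    and nrm: "x \<star> x = r" "y \<star> y = r" "z \<star> z = r" "w \<star> w = r"
    and eq: "x \<boxplus> y = z \<boxplus> w"
  shows "(z = x \<and> w = y) \<or> (z = y \<and> w = x) \<or> (x \<boxplus> y = (\<zero>, \<zero>) \<and> z \<boxplus> w = (\<zero>, \<zero>))"
proof -
  have r: "r \<in> carrier R" using P nrm by auto
  have eq': "y \<boxplus> x = z \<boxplus> w" using eq vadd_commute[OF P(1,2)] by (rule subst[rotated])
  have a: "x \<boxplus> y \<in> plane" and u: "z \<boxminus> x \<in> plane" and v: "z \<boxminus> y \<in> plane" using P by blast+
  have a': "y \<boxplus> x = x \<boxplus> y" using vadd_commute[OF P(2,1)] .
  note dots = vec_closed(1)[OF a u] vec_closed(1)[OF a v] vec_closed(1)[OF u v]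
  have "(x \<boxplus> y) \<star> (z \<boxminus> x) = \<zero>"
    using circle_identities(1)[OF P eq] r dots(1) unfolding nrm
    by (rule_tac double_eq_zero) (simp_all add: minus_eq r_neg)
  moreover have "(x \<boxplus> y) \<star> (z \<boxminus> y) = \<zero>"
    using circle_identities(1)[OF P(2,1,3,4) eq'] r dots(2) unfolding nrm a'
    by (rule_tac double_eq_zero) (simp_all add: minus_eq r_neg)
  moreover have "(z \<boxminus> x) \<star> (z \<boxminus> y) = \<zero>"
    using circle_identities(2)[OF P eq] r dots(3) unfolding nrm
    by (rule_tac double_eq_zero) (simp_all add: minus_eq r_neg)
  ultimately consider "x \<boxplus> y = (\<zero>, \<zero>)" | "z \<boxminus> x = (\<zero>, \<zero>)" | "z \<boxminus> y = (\<zero>, \<zero>)"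
    using mutually_orthogonal[OF a u v] by blast
  then show ?thesis
  proof cases
    case 1
    then show ?thesis using eq by simp
  next
    case 2
    then have "z = x" using vsub_eq_zero_iff[OF P(3,1)] by blast
    then show ?thesis using eq vadd_left_cancel[OF P(1,2,4)] by simp
  next
    case 3
    then have "z = y" using vsub_eq_zero_iff[OF P(3,2)] by blast
    then show ?thesis using eq' vadd_left_cancel[OF P(2,1,4)] by simp
  qed
qed

end

section \<open>Fourier analysis on the plane\<close>

text \<open>Expand the square and sum over \<open>t\<close> first. The labels \<open>a\<close> let
  different indices carry the same frequency. They are instantiated with points, with sums of two
  points, and with norms, where coinciding labels are what has to be counted.\<close>

lemma plancherel_general:
  fixes \<phi> :: "'i \<Rightarrow> 't \<Rightarrow> complex"
  assumes "finite I"
    and orth: "\<And>i j. \<lbrakk>i \<in> I; j \<in> I\<rbrakk> \<Longrightarrow>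
      (\<Sum>t\<in>T. \<phi> i t * cnj (\<phi> j t)) = (if a i = a j then of_real N else 0)"
  shows "complex_of_real (\<Sum>t\<in>T. (norm (\<Sum>i\<in>I. c i * \<phi> i t))\<^sup>2) =
    of_real N * (\<Sum>i\<in>I. \<Sum>j\<in>{j\<in>I. a j = a i}. c i * cnj (c j))"
proof -
  have "complex_of_real (\<Sum>t\<in>T. (norm (\<Sum>i\<in>I. c i * \<phi> i t))\<^sup>2)
      = (\<Sum>t\<in>T. \<Sum>i\<in>I. \<Sum>j\<in>I. c i * cnj (c j) * (\<phi> i t * cnj (\<phi> j t)))"
    unfolding of_real_sum complex_norm_square
    by (simp add: cnj_sum sum_product mult_ac)
  also have "\<dots> = (\<Sum>i\<in>I. \<Sum>t\<in>T. \<Sum>j\<in>I. c i * cnj (c j) * (\<phi> i t * cnj (\<phi> j t)))"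
    by (rule sum.swap)
  also have "\<dots> = (\<Sum>i\<in>I. \<Sum>j\<in>I. \<Sum>t\<in>T. c i * cnj (c j) * (\<phi> i t * cnj (\<phi> j t)))"
    by (intro sum.cong refl sum.swap)
  also have "\<dots> = (\<Sum>i\<in>I. \<Sum>j\<in>I. of_real N * (if a j = a i then c i * cnj (c j) else 0))"
    by (intro sum.cong refl) (auto simp: sum_distrib_left[symmetric] orth)
  also have "\<dots> = of_real N * (\<Sum>i\<in>I. \<Sum>j\<in>{j\<in>I. a j = a i}. c i * cnj (c j))"
    using \<open>finite I\<close> by (simp only: sum_distrib_left[where r = "complex_of_real N"] sum.inter_filter)
  finally show ?thesis .
qed

locale fourier_plane = anisotropic_plane R for R (structure) +
  fixes \<chi> :: "'a \<Rightarrow> complex"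
  assumes finite_carrier [simp]: "finite (carrier R)"
    and \<chi>_add: "a \<in> carrier R \<Longrightarrow> b \<in> carrier R \<Longrightarrow> \<chi> (a \<oplus> b) = \<chi> a * \<chi> b"
    and \<chi>_norm [simp]: "a \<in> carrier R \<Longrightarrow> norm (\<chi> a) = 1"
    and \<chi>_nontrivial: "\<exists>a\<in>carrier R. \<chi> a \<noteq> 1"
begin

abbreviation q :: real where
  "q \<equiv> real (card (carrier R))"

lemma q_pos: "q > 0"
  using finite_carrier zero_closed by (metis card_gt_0_iff empty_iff of_nat_0_less_iff)

lemma finite_plane [simp]: "finite plane"
  by simp

lemma \<chi>_zero [simp]: "\<chi> \<zero> = 1"
proof -
  have "\<chi> \<zero> * \<chi> \<zero> = \<chi> \<zero>" using \<chi>_add[of \<zero> \<zero>] by simp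
  moreover have "\<chi> \<zero> \<noteq> 0" using \<chi>_norm[of \<zero>] by force
  ultimately show ?thesis by simp
qed

lemma \<chi>_minus:
  assumes "a \<in> carrier R"
  shows "\<chi> (\<ominus> a) = cnj (\<chi> a)"
proof -
  have "\<chi> a * \<chi> (\<ominus> a) = 1" using \<chi>_add[of a "\<ominus> a"] assms by (simp add: r_neg)
  moreover have "\<chi> a * cnj (\<chi> a) = 1" using assms by (simp flip: complex_norm_square)
  moreover have "\<chi> a \<noteq> 0" using \<chi>_norm[OF assms] by force
  ultimately show ?thesis by (metis mult_cancel_left)
qed

lemma \<chi>_diff: "a \<in> carrier R \<Longrightarrow> b \<in> carrier R \<Longrightarrow> \<chi> (a \<ominus> b) = \<chi> a * cnj (\<chi> b)"
  by (simp add: minus_eq \<chi>_add \<chi>_minus)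

lemma bij_betw_translate:
  assumes "b \<in> carrier R"
  shows "bij_betw (\<lambda>a. a \<oplus> b) (carrier R) (carrier R)"
proof (rule bij_betw_byWitness[where f' = "\<lambda>a. a \<ominus> b"])
  show "\<forall>a\<in>carrier R. (a \<oplus> b) \<ominus> b = a" using assms by (auto simp: minus_eq a_assoc r_neg)
  show "\<forall>a\<in>carrier R. (a \<ominus> b) \<oplus> b = a" using assms by (auto simp: minus_eq a_assoc l_neg)
qed (use assms in auto)

lemma bij_betw_vtranslate:
  assumes "u \<in> plane"
  shows "bij_betw (\<lambda>x. x \<boxplus> u) plane plane"
proof (rule bij_betw_byWitness[where f' = "\<lambda>x. x \<boxminus> u"])
  show "\<forall>x\<in>plane. (x \<boxplus> u) \<boxminus> u = x"
    using assms by (auto simp: vadd_def vsub_def minus_eq a_assoc r_neg)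
  show "\<forall>x\<in>plane. (x \<boxminus> u) \<boxplus> u = x"
    using assms by (auto simp: vadd_def vsub_def minus_eq a_assoc l_neg)
qed (use assms vec_closed in blast)+

lemma sum_\<chi>:
  assumes a: "a \<in> carrier R"
  shows "(\<Sum>t\<in>carrier R. \<chi> (t \<otimes> a)) = (if a = \<zero> then of_real q else 0)"
proof (cases "a = \<zero>")
  case True
  then show ?thesis by simp
next
  case False
  then have unit: "a \<in> Units R" using a by (simp add: field_Units)
  obtain y where y: "y \<in> carrier R" "\<chi> y \<noteq> 1" using \<chi>_nontrivial by blast
  \<comment> \<open>Translating \<open>t\<close> by this \<open>z\<close> multiplies the whole sum
    by \<open>\<chi> y\<close>, which is not 1, so the sum is zero.\<close>
  define z where "z = y \<otimes> inv a"
  have z: "z \<in> carrier R" "z \<otimes> a = y"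
    using y unit a unfolding z_def by (auto simp: m_assoc)
  have "(\<Sum>t\<in>carrier R. \<chi> (t \<otimes> a)) = (\<Sum>t\<in>carrier R. \<chi> ((t \<oplus> z) \<otimes> a))"
    by (rule sum.reindex_bij_betw[symmetric, OF bij_betw_translate[OF z(1)]])
  also have "\<dots> = \<chi> y * (\<Sum>t\<in>carrier R. \<chi> (t \<otimes> a))"
    unfolding sum_distrib_left using a y z by (intro sum.cong refl) (simp add: l_distr \<chi>_add)
  finally show ?thesis using y False by simp
qed

lemma orthogonality_line:
  assumes "a \<in> carrier R" "b \<in> carrier R"
  shows "(\<Sum>t\<in>carrier R. \<chi> (t \<otimes> a) * cnj (\<chi> (t \<otimes> b))) = (if a = b then of_real q else 0)"
proof -
  have "(\<Sum>t\<in>carrier R. \<chi> (t \<otimes> a) * cnj (\<chi> (t \<otimes> b))) = (\<Sum>t\<in>carrier R. \<chi> (t \<otimes> (a \<ominus> b)))"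
    using assms by (intro sum.cong refl) (simp add: r_distr r_minus minus_eq \<chi>_add \<chi>_minus)
  then show ?thesis using assms sum_\<chi>[of "a \<ominus> b"] by simp
qed

lemma sum_\<chi>_dot:
  assumes "a \<in> plane"
  shows "(\<Sum>x\<in>plane. \<chi> (x \<star> a)) = (if a = (\<zero>, \<zero>) then of_real (q\<^sup>2) else 0)"
proof -
  have "(\<Sum>x\<in>plane. \<chi> (x \<star> a))
      = (\<Sum>s\<in>carrier R. \<Sum>t\<in>carrier R. \<chi> (s \<otimes> fst a) * \<chi> (t \<otimes> snd a))"
    unfolding sum.cartesian_product
    using assms by (intro sum.cong refl) (auto simp: dot_def \<chi>_add)
  also have "\<dots> = (\<Sum>s\<in>carrier R. \<chi> (s \<otimes> fst a)) * (\<Sum>t\<in>carrier R. \<chi> (t \<otimes> snd a))"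
    by (simp add: sum_product)
  finally show ?thesis using assms by (auto simp: sum_\<chi> prod_eq_iff power2_eq_square)
qed

lemma orthogonality_plane:
  assumes "a \<in> plane" "b \<in> plane"
  shows "(\<Sum>x\<in>plane. \<chi> (x \<star> a) * cnj (\<chi> (x \<star> b))) = (if a = b then of_real (q\<^sup>2) else 0)"
proof -
  have "(\<Sum>x\<in>plane. \<chi> (x \<star> a) * cnj (\<chi> (x \<star> b))) = (\<Sum>x\<in>plane. \<chi> (x \<star> (a \<boxminus> b)))"
    using assms by (intro sum.cong refl) (simp add: dot_vsub_right \<chi>_diff)
  then show ?thesis using assms sum_\<chi>_dot[of "a \<boxminus> b"] vsub_eq_zero_iff by simp
qed

text \<open>Unnormalised transform of the indicator of \<open>E\<close>; the factor
  \<open>q\<^sup>2\<close> therefore appears in Plancherel's identity.\<close>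

definition fourier :: "('a \<times> 'a) set \<Rightarrow> 'a \<times> 'a \<Rightarrow> complex" where
  "fourier E \<xi> = (\<Sum>x\<in>E. \<chi> (\<xi> \<star> x))"

lemma plancherel:
  assumes "E \<subseteq> plane"
  shows "(\<Sum>\<xi>\<in>plane. (norm (fourier E \<xi>))\<^sup>2) = q\<^sup>2 * card E"
proof -
  have "finite E" using assms finite_plane by (rule finite_subset)
  have "complex_of_real (\<Sum>\<xi>\<in>plane. (norm (\<Sum>x\<in>E. 1 * \<chi> (\<xi> \<star> x)))\<^sup>2) =
      of_real (q\<^sup>2) * (\<Sum>x\<in>E. \<Sum>y\<in>{y\<in>E. y = x}. 1 * cnj 1)"
    using assms by (intro plancherel_general \<open>finite E\<close> orthogonality_plane) auto
  also have "(\<Sum>x\<in>E. \<Sum>y\<in>{y\<in>E. y = x}. 1 * cnj (1::complex)) = (\<Sum>x\<in>E. 1)"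
  proof (rule sum.cong[OF refl])
    fix x assume "x \<in> E"
    then have "{y\<in>E. y = x} = {x}" by auto
    then show "(\<Sum>y\<in>{y\<in>E. y = x}. 1 * cnj (1::complex)) = 1" by simp
  qed
  finally have "complex_of_real (\<Sum>\<xi>\<in>plane. (norm (fourier E \<xi>))\<^sup>2) = of_real (q\<^sup>2 * card E)"
    unfolding fourier_def by simp
  then show ?thesis using of_real_eq_iff by blast
qed

text \<open>As 4 is even, the fourth power is the squared modulus of a sum over pairs of circle
  points, with frequency the sum of the pair. Plancherel then leaves a weighted count of pairs of
  pairs with equal sums.\<close>

lemma circle_extension_L4:
  assumes S: "S = {\<xi>\<in>plane. \<xi> \<star> \<xi> = r}"
  shows "(\<Sum>x\<in>plane. (norm (\<Sum>\<xi>\<in>S. g \<xi> * \<chi> (\<xi> \<star> x))) ^ 4) \<le> 3 * q\<^sup>2 * (\<Sum>\<xi>\<in>S. (norm (g \<xi>))\<^sup>2)\<^sup>2"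
proof -
  define M where "M = (\<Sum>\<xi>\<in>S. (norm (g \<xi>))\<^sup>2)"
  have "finite S" unfolding S using finite_plane by simp
  have SP: "S \<subseteq> plane" unfolding S by blast
  define a where "a p = fst p \<boxplus> snd p" for p
  define c where "c p = g (fst p) * g (snd p)" for p
  define w where "w p = norm (c p)" for p
  let ?I = "S \<times> S" and ?o = "(\<zero>, \<zero>)"
  have fin: "finite ?I" using \<open>finite S\<close> by simp
  have a_in: "a p \<in> plane" if "p \<in> ?I" for p
    unfolding a_def using SP that by (intro vec_closed(2)) (auto dest!: subsetD[OF SP])
  have norm4: "(norm (\<Sum>\<xi>\<in>S. g \<xi> * \<chi> (\<xi> \<star> x))) ^ 4 = (norm (\<Sum>p\<in>?I. c p * \<chi> (x \<star> a p)))\<^sup>2"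
    if x: "x \<in> plane" for x
  proof -
    have "(\<Sum>\<xi>\<in>S. g \<xi> * \<chi> (\<xi> \<star> x))\<^sup>2 = (\<Sum>p\<in>?I. c p * \<chi> (x \<star> a p))"
      unfolding power2_eq_square sum_product sum.cartesian_product
    proof (rule sum.cong[OF refl], clarify)
      fix \<xi> \<eta> assume "\<xi> \<in> S" "\<eta> \<in> S"
      then have "\<xi> \<in> plane" "\<eta> \<in> plane" using SP by blast+
      then have "x \<star> a (\<xi>, \<eta>) = \<xi> \<star> x \<oplus> \<eta> \<star> x"
        using x dot_commute[of x "\<xi> \<boxplus> \<eta>"] unfolding a_def by (simp add: dot_vadd_left)
      then show "g \<xi> * \<chi> (\<xi> \<star> x) * (g \<eta> * \<chi> (\<eta> \<star> x)) = c (\<xi>, \<eta>) * \<chi> (x \<star> a (\<xi>, \<eta>))"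
        using \<open>\<xi> \<in> plane\<close> \<open>\<eta> \<in> plane\<close> x unfolding c_def by (simp add: \<chi>_add)
    qed
    moreover have "(norm z) ^ 4 = (norm (z\<^sup>2))\<^sup>2" for z :: complex
      by (simp add: norm_power flip: power_mult)
    ultimately show ?thesis by simp
  qed
  have "complex_of_real (\<Sum>x\<in>plane. (norm (\<Sum>p\<in>?I. c p * \<chi> (x \<star> a p)))\<^sup>2)
      = of_real (q\<^sup>2) * (\<Sum>p\<in>?I. \<Sum>p'\<in>{p'\<in>?I. a p' = a p}. c p * cnj (c p'))"
    by (rule plancherel_general[OF fin]) (rule orthogonality_plane; rule a_in)
  \<comment> \<open>The left side is real and nonnegative, hence equals the modulus of the complex
    expression, to which the triangle inequality applies.\<close>
  then have "(\<Sum>x\<in>plane. (norm (\<Sum>p\<in>?I. c p * \<chi> (x \<star> a p)))\<^sup>2)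
      = norm (of_real (q\<^sup>2) * (\<Sum>p\<in>?I. \<Sum>p'\<in>{p'\<in>?I. a p' = a p}. c p * cnj (c p')))"
    by (metis (no_types, lifting) norm_of_real abs_of_nonneg sum_nonneg zero_le_power2)
  also have "\<dots> \<le> q\<^sup>2 * (\<Sum>p\<in>?I. \<Sum>p'\<in>{p'\<in>?I. a p' = a p}. w p * w p')"
  proof -
    have "norm (\<Sum>p\<in>?I. \<Sum>p'\<in>{p'\<in>?I. a p' = a p}. c p * cnj (c p'))
        \<le> (\<Sum>p\<in>?I. \<Sum>p'\<in>{p'\<in>?I. a p' = a p}. norm (c p * cnj (c p')))"
      by (intro order_trans[OF norm_sum] sum_mono norm_sum)
    then have le: "norm (\<Sum>p\<in>?I. \<Sum>p'\<in>{p'\<in>?I. a p' = a p}. c p * cnj (c p'))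
        \<le> (\<Sum>p\<in>?I. \<Sum>p'\<in>{p'\<in>?I. a p' = a p}. w p * w p')"
      by (simp only: norm_mult complex_mod_cnj w_def)
    have q2: "norm (complex_of_real (q\<^sup>2)) = q\<^sup>2" by (simp only: norm_of_real) simp
    show ?thesis
      unfolding norm_mult q2 using le by (rule mult_left_mono) simp
  qed
  also have "(\<Sum>p\<in>?I. \<Sum>p'\<in>{p'\<in>?I. a p' = a p}. w p * w p') \<le> 3 * M\<^sup>2"
  proof -
    txt \<open>A pair with the same sum as \<open>p\<close> is \<open>p\<close>, its swap, or, like \<open>p\<close>, a pair with sum zero;
      each of the three contributions is at most \<open>M\<^sup>2\<close>.\<close>
    have w_nonneg: "0 \<le> w p" for p unfolding w_def by simp
    let ?Z = "{p\<in>?I. a p = ?o}"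
    have "(\<Sum>p'\<in>{p'\<in>?I. a p' = a p}. w p * w p')
        \<le> w p * w p + w p * w (prod.swap p) + (if a p = ?o then w p * sum w ?Z else 0)"
      if p: "p \<in> ?I" for p
    proof -
      have "{p'\<in>?I. a p' = a p} \<subseteq> {p} \<union> {prod.swap p} \<union> (if a p = ?o then ?Z else {})"
      proof
        fix p' assume p': "p' \<in> {p'\<in>?I. a p' = a p}"
        have "fst p \<in> S" "snd p \<in> S" "fst p' \<in> S" "snd p' \<in> S" using p p' by auto
        then show "p' \<in> {p} \<union> {prod.swap p} \<union> (if a p = ?o then ?Z else {})"
          using circle_sum_eq_cases[of "fst p" "snd p" "fst p'" "snd p'" r] p'
          unfolding S a_def by (auto simp: prod_eq_iff)
      qed
      then have *: "(\<Sum>p'\<in>{p'\<in>?I. a p' = a p}. w p * w p')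
          \<le> (\<Sum>p'\<in>{p} \<union> {prod.swap p} \<union> (if a p = ?o then ?Z else {}). w p * w p')"
        using w_nonneg fin by (intro sum_mono2) auto
      \<comment> \<open>The three sets may overlap, for instance when \<open>p\<close> is its own
        swap; nonnegative weights make the sum over a union subadditive.\<close>
      have union_le: "(\<Sum>p'\<in>X \<union> Y. w p * w p') \<le> (\<Sum>p'\<in>X. w p * w p') + (\<Sum>p'\<in>Y. w p * w p')"
        if "finite X" "finite Y" for X Y
      proof -
        have "0 \<le> (\<Sum>p'\<in>X \<inter> Y. w p * w p')" using w_nonneg by (intro sum_nonneg) auto
        then show ?thesis using sum.union_inter[OF that, of "\<lambda>p'. w p * w p'"] by linarith
      qed
      note *
      also have "(\<Sum>p'\<in>{p} \<union> {prod.swap p} \<union> (if a p = ?o then ?Z else {}). w p * w p') \<le> (\<Sum>p'\<in>{p}. w p * w p') + (\<Sum>p'\<in>{prod.swap p}. w p * w p')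
          + (\<Sum>p'\<in>(if a p = ?o then ?Z else {}). w p * w p')"
      proof -
        have "finite ({p} \<union> {prod.swap p})" "finite {p}" "finite {prod.swap p}"
          "finite (if a p = ?o then ?Z else {})"
          using fin by simp_all
        then show ?thesis
          using union_le[of "{p} \<union> {prod.swap p}" "if a p = ?o then ?Z else {}"]
            union_le[of "{p}" "{prod.swap p}"] by linarith
      qed
      finally show ?thesis by (auto simp: sum_distrib_left)
    qed
    then have "(\<Sum>p\<in>?I. \<Sum>p'\<in>{p'\<in>?I. a p' = a p}. w p * w p')
      \<le> (\<Sum>p\<in>?I. w p * w p + w p * w (prod.swap p) + (if a p = ?o then w p * sum w ?Z else 0))"
      by (rule sum_mono)
    also have "\<dots> = (\<Sum>p\<in>?I. w p * w p) + (\<Sum>p\<in>?I. w p * w (prod.swap p)) + (sum w ?Z)\<^sup>2"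
      using fin by (simp add: sum.distrib sum.inter_filter[symmetric] power2_eq_square sum_distrib_right)
    also have "(\<Sum>p\<in>?I. w p * w p) = M\<^sup>2"
      unfolding M_def power2_eq_square[of "sum _ _"] sum_product sum.cartesian_product w_def c_def
      by (intro sum.cong refl) (auto simp: norm_mult power2_eq_square)
    \<comment> \<open>The weight is symmetric in the two points, so swapping changes
      nothing.\<close>
    also have "(\<Sum>p\<in>?I. w p * w (prod.swap p)) = M\<^sup>2"
      unfolding M_def power2_eq_square[of "sum _ _"] sum_product sum.cartesian_product w_def c_def
      by (intro sum.cong refl) (auto simp: norm_mult power2_eq_square)
    \<comment> \<open>In a pair with sum zero either point determines the other. Both projections
      are thus injective, and Cauchy-Schwarz bounds the sum by \<open>M\<close>.\<close>
    also have "(sum w ?Z)\<^sup>2 \<le> M\<^sup>2"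
    proof -
      have M_bound: "(\<Sum>p\<in>?Z. (norm (g (f p)))\<^sup>2) \<le> M" if "inj_on f ?Z" "f ` ?Z \<subseteq> S" for f
        unfolding M_def using that \<open>finite S\<close>
        by (subst sum.reindex[OF that(1), of "\<lambda>\<xi>. (norm (g \<xi>))\<^sup>2", unfolded o_def, symmetric])
          (auto intro: sum_mono2)
      have "inj_on fst ?Z"
      proof (rule inj_onI)
        fix p p' assume pp: "p \<in> ?Z" "p' \<in> ?Z" "fst p = fst p'"
        then have P: "fst p \<in> plane" "snd p \<in> plane" "snd p' \<in> plane" using SP by auto
        have "fst p \<boxplus> snd p = fst p \<boxplus> snd p'" using pp unfolding a_def by auto
        then show "p = p'" using vadd_left_cancel[OF P] pp(3) by (simp add: prod_eq_iff)
      qed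
      moreover have "inj_on snd ?Z"
      proof (rule inj_onI)
        fix p p' assume pp: "p \<in> ?Z" "p' \<in> ?Z" "snd p = snd p'"
        then have P: "fst p \<in> plane" "snd p \<in> plane" "fst p' \<in> plane" 
          using SP by auto
        have "fst p \<boxplus> snd p = fst p' \<boxplus> snd p" using pp unfolding a_def by auto
        then have "snd p \<boxplus> fst p = snd p \<boxplus> fst p'"
          unfolding vadd_commute[OF P(1,2)] vadd_commute[OF P(3,2)] .
        then have "fst p = fst p'"
          using vadd_left_cancel[OF P(2,1,3)] by simp
        then show "p = p'" using pp by (simp add: prod_eq_iff)
      qed
      ultimately have "(\<Sum>p\<in>?Z. (norm (g (fst p)))\<^sup>2) * (\<Sum>p\<in>?Z. (norm (g (snd p)))\<^sup>2) \<le> M * M"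
        by (intro mult_mono M_bound) (auto simp: sum_nonneg M_def)
      then show ?thesis
        using Cauchy_Schwarz_ineq_sum[of "\<lambda>p. norm (g (fst p))" "\<lambda>p. norm (g (snd p))" ?Z]
        unfolding w_def c_def norm_mult by (simp add: power2_eq_square)
    qed
    finally show ?thesis by simp
  qed
  finally have "(\<Sum>x\<in>plane. (norm (\<Sum>p\<in>?I. c p * \<chi> (x \<star> a p)))\<^sup>2) \<le> q\<^sup>2 * (3 * M\<^sup>2)"
    by (simp add: mult_left_mono)
  then show ?thesis unfolding M_def by (simp add: norm4 cong: sum.cong)
qed

text \<open>Duality: the circle mass M is the sum over \<open>E\<close> of the extension of the
  conjugate transform. Two applications of Cauchy-Schwarz and the L^4 estimate give M^4 \<le> |E|^3
  * 3 q^2 M^2, and M^2 cancels.\<close>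

lemma circle_energy_bound:
  assumes E: "E \<subseteq> plane"
  shows "(\<Sum>\<xi>\<in>{\<xi>\<in>plane. \<xi> \<star> \<xi> = r}. (norm (fourier E \<xi>))\<^sup>2)\<^sup>2 \<le> 3 * q\<^sup>2 * (card E) ^ 3"
proof -
  define S where "S = {\<xi>\<in>plane. \<xi> \<star> \<xi> = r}"
  define M where "M = (\<Sum>\<xi>\<in>S. (norm (fourier E \<xi>))\<^sup>2)"
  define H where "H x = (\<Sum>\<xi>\<in>S. cnj (fourier E \<xi>) * \<chi> (\<xi> \<star> x))" for x
  have "finite E" using E finite_plane by (rule finite_subset)
  have M_nonneg: "0 \<le> M" unfolding M_def by (simp add: sum_nonneg)
  have "complex_of_real M = (\<Sum>\<xi>\<in>S. cnj (fourier E \<xi>) * (\<Sum>x\<in>E. \<chi> (\<xi> \<star> x)))"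
    unfolding M_def fourier_def[symmetric] of_real_sum complex_norm_square by (simp add: mult.commute)
  also have "\<dots> = (\<Sum>x\<in>E. H x)"
    unfolding H_def sum_distrib_left by (rule sum.swap)
  finally have "M = norm (\<Sum>x\<in>E. H x)" using M_nonneg by (metis abs_of_nonneg norm_of_real)
  then have "M \<le> (\<Sum>x\<in>E. norm (H x))" using norm_sum by metis
  then have "M\<^sup>2 \<le> (\<Sum>x\<in>E. norm (H x))\<^sup>2" using M_nonneg by (intro power_mono)
  also have "\<dots> \<le> card E * (\<Sum>x\<in>E. (norm (H x))\<^sup>2)"
    using Cauchy_Schwarz_ineq_sum[of "\<lambda>_. 1" "\<lambda>x. norm (H x)" E] by simp
  finally have "(M\<^sup>2)\<^sup>2 \<le> (card E * (\<Sum>x\<in>E. (norm (H x))\<^sup>2))\<^sup>2" by (intro power_mono) auto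
  also have "\<dots> = (card E)\<^sup>2 * (\<Sum>x\<in>E. (norm (H x))\<^sup>2)\<^sup>2" by (simp add: power_mult_distrib)
  also have "\<dots> \<le> (card E)\<^sup>2 * (card E * (\<Sum>x\<in>E. (norm (H x)) ^ 4))"
    using Cauchy_Schwarz_ineq_sum[of "\<lambda>_. 1" "\<lambda>x. (norm (H x))\<^sup>2" E]
    by (intro mult_left_mono) (simp_all flip: power_mult)
  also have "\<dots> \<le> (card E)\<^sup>2 * (card E * (3 * q\<^sup>2 * M\<^sup>2))"
  proof -
    \<comment> \<open>Positivity allows the sum over \<open>E\<close> to be enlarged to the whole
      plane, where the extension estimate applies.\<close>
    have "(\<Sum>x\<in>E. (norm (H x)) ^ 4) \<le> (\<Sum>x\<in>plane. (norm (H x)) ^ 4)"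
      using E by (intro sum_mono2) auto
    also have "\<dots> \<le> 3 * q\<^sup>2 * M\<^sup>2"
      using circle_extension_L4[OF S_def, of "\<lambda>\<xi>. cnj (fourier E \<xi>)"] unfolding H_def M_def by simp
    finally show ?thesis by (intro mult_left_mono) auto
  qed
  finally have "M\<^sup>2 * M\<^sup>2 \<le> (3 * q\<^sup>2 * (card E) ^ 3) * M\<^sup>2"
    by (simp add: power2_eq_square power3_eq_cube mult_ac)
  then have "M\<^sup>2 \<le> 3 * q\<^sup>2 * (card E) ^ 3"
    by (cases "M = 0") (simp, metis mult_right_le_imp_le zero_less_power2 of_nat_power)
  then show ?thesis unfolding M_def S_def .
qed

section \<open>The transform of the distance counting function\<close>

text \<open>The Fourier transform of the function that counts, for each distance, the ordered pairs
  of \<open>E\<close> realising it.\<close>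

definition dist_transform :: "('a \<times> 'a) set \<Rightarrow> 'a \<Rightarrow> complex" where
  "dist_transform E t = (\<Sum>x\<in>E. \<Sum>y\<in>E. \<chi> (t \<otimes> ((x \<boxminus> y) \<star> (x \<boxminus> y))))"

text \<open>A quadratic Gauss sum in two variables, hence of modulus q rather than the square root
  of q.\<close>

definition gauss :: "'a \<Rightarrow> complex" where
  "gauss s = (\<Sum>\<xi>\<in>plane. \<chi> (s \<otimes> (\<xi> \<star> \<xi>)))"

text \<open>Grouped by the value of \<open>\<xi> \<star> \<xi>\<close>, this is the Fourier
  transform of the masses that the squared transform of \<open>E\<close> puts on the
  circles.\<close>

definition norm_transform :: "('a \<times> 'a) set \<Rightarrow> 'a \<Rightarrow> complex" where
  "norm_transform E s = (\<Sum>\<xi>\<in>plane. of_real ((norm (fourier E \<xi>))\<^sup>2) * \<chi> (s \<otimes> (\<xi> \<star> \<xi>)))"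

text \<open>Expand the squared modulus and translate \<open>\<xi>\<close> by \<open>\<eta>\<close>.
  The quadratic terms in \<open>\<eta>\<close> cancel, the phase becomes linear in
  \<open>\<eta>\<close>, and orthogonality leaves only \<open>\<xi>\<close> = 0.\<close>

lemma norm_gauss:
  assumes s: "s \<in> carrier R" "s \<noteq> \<zero>"
  shows "norm (gauss s) = q"
proof -
  have inner: "(\<Sum>\<xi>\<in>plane. \<chi> (s \<otimes> (\<xi> \<star> \<xi>)) * cnj (\<chi> (s \<otimes> (\<eta> \<star> \<eta>)))) =
      (\<Sum>\<xi>\<in>plane. \<chi> (s \<otimes> (\<xi> \<star> \<xi>)) * \<chi> (\<eta> \<star> scale (s \<oplus> s) \<xi>))"
    if \<eta>: "\<eta> \<in> plane" for \<eta>
  proof -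
    have "(\<Sum>\<xi>\<in>plane. \<chi> (s \<otimes> (\<xi> \<star> \<xi>)) * cnj (\<chi> (s \<otimes> (\<eta> \<star> \<eta>)))) =
        (\<Sum>\<xi>\<in>plane. \<chi> (s \<otimes> ((\<xi> \<boxplus> \<eta>) \<star> (\<xi> \<boxplus> \<eta>))) * cnj (\<chi> (s \<otimes> (\<eta> \<star> \<eta>))))"
      by (rule sum.reindex_bij_betw[symmetric, OF bij_betw_vtranslate[OF \<eta>]])
    also have "\<dots> = (\<Sum>\<xi>\<in>plane. \<chi> (s \<otimes> (\<xi> \<star> \<xi>)) * \<chi> (\<eta> \<star> scale (s \<oplus> s) \<xi>))"
    proof (rule sum.cong[OF refl])
      fix \<xi> assume \<xi>: "\<xi> \<in> plane"
      let ?z = "s \<otimes> (\<eta> \<star> \<eta>)"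
      have mem: "s \<otimes> (\<xi> \<star> \<xi>) \<in> carrier R" "\<eta> \<star> scale (s \<oplus> s) \<xi> \<in> carrier R" "?z \<in> carrier R"
        using \<xi> \<eta> s by (auto intro!: vec_closed scale_closed)
      have "\<chi> ?z * cnj (\<chi> ?z) = 1" using mem by (simp flip: complex_norm_square)
      then show "\<chi> (s \<otimes> ((\<xi> \<boxplus> \<eta>) \<star> (\<xi> \<boxplus> \<eta>))) * cnj (\<chi> ?z) =
          \<chi> (s \<otimes> (\<xi> \<star> \<xi>)) * \<chi> (\<eta> \<star> scale (s \<oplus> s) \<xi>)"
        unfolding norm_vadd_expand[OF \<xi> \<eta> s(1)] using mem by (simp add: \<chi>_add mult.assoc)
    qed
    finally show ?thesis .
  qed
  have "complex_of_real ((norm (gauss s))\<^sup>2) =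
      (\<Sum>\<xi>\<in>plane. \<Sum>\<eta>\<in>plane. \<chi> (s \<otimes> (\<xi> \<star> \<xi>)) * cnj (\<chi> (s \<otimes> (\<eta> \<star> \<eta>))))"
    unfolding complex_norm_square gauss_def cnj_sum sum_product ..
  also have "\<dots> = (\<Sum>\<eta>\<in>plane. \<Sum>\<xi>\<in>plane. \<chi> (s \<otimes> (\<xi> \<star> \<xi>)) * cnj (\<chi> (s \<otimes> (\<eta> \<star> \<eta>))))"
    by (rule sum.swap)
  also have "\<dots> = (\<Sum>\<eta>\<in>plane. \<Sum>\<xi>\<in>plane. \<chi> (s \<otimes> (\<xi> \<star> \<xi>)) * \<chi> (\<eta> \<star> scale (s \<oplus> s) \<xi>))"
    by (rule sum.cong[OF refl inner])
  also have "\<dots> = (\<Sum>\<xi>\<in>plane. \<Sum>\<eta>\<in>plane. \<chi> (s \<otimes> (\<xi> \<star> \<xi>)) * \<chi> (\<eta> \<star> scale (s \<oplus> s) \<xi>))"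
    by (rule sum.swap)
  also have "\<dots> = (\<Sum>\<xi>\<in>plane. if \<xi> = (\<zero>, \<zero>) then of_real (q\<^sup>2) else 0)"
  proof (rule sum.cong[OF refl])
    fix \<xi> assume \<xi>: "\<xi> \<in> plane"
    \<comment> \<open>Odd characteristic enters here: the linear phase in \<open>\<eta>\<close> is
      trivial only at the origin.\<close>
    have "s \<oplus> s \<noteq> \<zero>" using double_eq_zero s by blast
    then have "scale (s \<oplus> s) \<xi> = (\<zero>, \<zero>) \<longleftrightarrow> \<xi> = (\<zero>, \<zero>)"
      using \<xi> s by (auto simp: scale_def prod_eq_iff integral_iff)
    then have "(\<Sum>\<eta>\<in>plane. \<chi> (\<eta> \<star> scale (s \<oplus> s) \<xi>)) = (if \<xi> = (\<zero>, \<zero>) then of_real (q\<^sup>2) else 0)"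
      using sum_\<chi>_dot[of "scale (s \<oplus> s) \<xi>"] \<xi> s by simp
    then show "(\<Sum>\<eta>\<in>plane. \<chi> (s \<otimes> (\<xi> \<star> \<xi>)) * \<chi> (\<eta> \<star> scale (s \<oplus> s) \<xi>)) =
        (if \<xi> = (\<zero>, \<zero>) then of_real (q\<^sup>2) else 0)"
      unfolding sum_distrib_left[symmetric] using s by (simp add: dot_def)
  qed
  also have "\<dots> = of_real (q\<^sup>2)"
    by (subst sum.delta[OF finite_plane]) simp
  finally have "(norm (gauss s))\<^sup>2 = q\<^sup>2" by (simp only: of_real_eq_iff)
  then show ?thesis using q_pos by simp
qed

text \<open>Expanding the squared Fourier transform gives, for each pair x, y in \<open>E\<close>, a
  quadratic character sum over \<open>\<xi>\<close>. Completing the square evaluates it as the Gauss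
  sum times a conjugate phase at the distance of x and y. Only moduli are compared, so the phase of
  the Gauss sum is immaterial.\<close>

lemma norm_norm_transform:
  assumes E: "E \<subseteq> plane" and s: "s \<in> carrier R" and t: "t \<in> carrier R"
    and inverse: "s \<otimes> ((t \<oplus> t) \<oplus> (t \<oplus> t)) = \<one>"
  shows "norm (norm_transform E s) = q * norm (dist_transform E t)"
proof -
  have "norm_transform E s = (\<Sum>\<xi>\<in>plane. \<Sum>x\<in>E. \<Sum>y\<in>E. \<chi> (s \<otimes> (\<xi> \<star> \<xi>) \<oplus> \<xi> \<star> (x \<boxminus> y)))"
    unfolding norm_transform_def
  proof (rule sum.cong[OF refl])
    fix \<xi> assume \<xi>: "\<xi> \<in> plane"
    have "of_real ((norm (fourier E \<xi>))\<^sup>2) * \<chi> (s \<otimes> (\<xi> \<star> \<xi>)) =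
        (\<Sum>x\<in>E. \<Sum>y\<in>E. \<chi> (\<xi> \<star> x) * cnj (\<chi> (\<xi> \<star> y)) * \<chi> (s \<otimes> (\<xi> \<star> \<xi>)))"
      unfolding complex_norm_square fourier_def cnj_sum sum_product by (simp add: sum_distrib_right)
    also have "\<dots> = (\<Sum>x\<in>E. \<Sum>y\<in>E. \<chi> (s \<otimes> (\<xi> \<star> \<xi>) \<oplus> \<xi> \<star> (x \<boxminus> y)))"
    proof (intro sum.cong refl)
      fix x y assume "x \<in> E" "y \<in> E"
      then have P: "x \<in> plane" "y \<in> plane" using E by blast+
      show "\<chi> (\<xi> \<star> x) * cnj (\<chi> (\<xi> \<star> y)) * \<chi> (s \<otimes> (\<xi> \<star> \<xi>)) = \<chi> (s \<otimes> (\<xi> \<star> \<xi>) \<oplus> \<xi> \<star> (x \<boxminus> y))"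
        using P \<xi> s by (simp add: \<chi>_add \<chi>_diff dot_vsub_right)
    qed
    finally show "of_real ((norm (fourier E \<xi>))\<^sup>2) * \<chi> (s \<otimes> (\<xi> \<star> \<xi>)) = \<dots>" .
  qed
  also have "\<dots> = (\<Sum>x\<in>E. \<Sum>\<xi>\<in>plane. \<Sum>y\<in>E. \<chi> (s \<otimes> (\<xi> \<star> \<xi>) \<oplus> \<xi> \<star> (x \<boxminus> y)))"
    by (rule sum.swap)
  also have "\<dots> = (\<Sum>x\<in>E. \<Sum>y\<in>E. \<Sum>\<xi>\<in>plane. \<chi> (s \<otimes> (\<xi> \<star> \<xi>) \<oplus> \<xi> \<star> (x \<boxminus> y)))"
    by (intro sum.cong[OF refl] sum.swap)
  also have "\<dots> = (\<Sum>x\<in>E. \<Sum>y\<in>E. gauss s * cnj (\<chi> (t \<otimes> ((x \<boxminus> y) \<star> (x \<boxminus> y)))))"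
  proof (intro sum.cong refl)
    fix x y assume "x \<in> E" "y \<in> E"
    then have "x \<in> plane" "y \<in> plane" using E by blast+
    then have "x \<boxminus> y \<in> plane" by (rule vec_closed)
    moreover define v where "v = x \<boxminus> y"
    ultimately have v: "v \<in> plane" by simp
    have c: "scale (t \<oplus> t) v \<in> plane" using v t by blast
    have "(\<Sum>\<xi>\<in>plane. \<chi> (s \<otimes> (\<xi> \<star> \<xi>) \<oplus> \<xi> \<star> v)) =
        (\<Sum>\<xi>\<in>plane. \<chi> (s \<otimes> ((\<xi> \<boxplus> scale (t \<oplus> t) v) \<star> (\<xi> \<boxplus> scale (t \<oplus> t) v))) * cnj (\<chi> (t \<otimes> (v \<star> v))))"
    proof (rule sum.cong[OF refl])
      fix \<xi> assume \<xi>: "\<xi> \<in> plane"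
      show "\<chi> (s \<otimes> (\<xi> \<star> \<xi>) \<oplus> \<xi> \<star> v) =
          \<chi> (s \<otimes> ((\<xi> \<boxplus> scale (t \<oplus> t) v) \<star> (\<xi> \<boxplus> scale (t \<oplus> t) v))) * cnj (\<chi> (t \<otimes> (v \<star> v)))"
        unfolding complete_square[OF \<xi> v s t inverse]
        by (rule \<chi>_diff) (use \<xi> v c s t in \<open>auto intro!: vec_closed\<close>)
    qed
    also have "\<dots> = (\<Sum>\<xi>\<in>plane. \<chi> (s \<otimes> (\<xi> \<star> \<xi>)) * cnj (\<chi> (t \<otimes> (v \<star> v))))"
      by (rule sum.reindex_bij_betw[OF bij_betw_vtranslate[OF c]])
    also have "\<dots> = gauss s * cnj (\<chi> (t \<otimes> (v \<star> v)))"
      unfolding gauss_def sum_distrib_right ..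
    finally show "(\<Sum>\<xi>\<in>plane. \<chi> (s \<otimes> (\<xi> \<star> \<xi>) \<oplus> \<xi> \<star> (x \<boxminus> y))) =
        gauss s * cnj (\<chi> (t \<otimes> ((x \<boxminus> y) \<star> (x \<boxminus> y))))" unfolding v_def .
  qed
  also have "\<dots> = gauss s * cnj (dist_transform E t)"
    unfolding dist_transform_def cnj_sum sum_distrib_left ..
  finally have "norm (norm_transform E s) = norm (gauss s) * norm (dist_transform E t)"
    by (simp add: norm_mult)
  moreover have "s \<noteq> \<zero>" using inverse t by auto
  ultimately show ?thesis using norm_gauss s by simp
qed

lemma four_unit:
  assumes "t \<in> carrier R" "t \<noteq> \<zero>"
  shows "(t \<oplus> t) \<oplus> (t \<oplus> t) \<in> Units R"
proof -
  have "t \<oplus> t \<noteq> \<zero>" using assms double_eq_zero by blast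
  then have "(t \<oplus> t) \<oplus> (t \<oplus> t) \<noteq> \<zero>" using assms double_eq_zero[of "t \<oplus> t"] by blast
  then show ?thesis using assms by (simp add: field_Units)
qed

lemma norm_transform_eq:
  assumes E: "E \<subseteq> plane" and t: "t \<in> carrier R" "t \<noteq> \<zero>"
  shows "norm (norm_transform E (inv ((t \<oplus> t) \<oplus> (t \<oplus> t)))) = q * norm (dist_transform E t)"
  using four_unit[OF t] by (intro norm_norm_transform E t) auto

text \<open>The triangle inequality is applied on the frequency side, where Plancherel gives total
  mass q^2 |E|; for |E| > q this beats the direct bound |E|^2.\<close>

lemma dist_transform_bound:
  assumes E: "E \<subseteq> plane" and t: "t \<in> carrier R" "t \<noteq> \<zero>"
  shows "norm (dist_transform E t) \<le> q * card E"
proof -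
  let ?s = "inv ((t \<oplus> t) \<oplus> (t \<oplus> t))"
  have s: "?s \<in> carrier R" using four_unit[OF t] by simp
  have "q * norm (dist_transform E t) = norm (norm_transform E ?s)"
    using norm_transform_eq[OF assms] by simp
  also have "\<dots> \<le> (\<Sum>\<xi>\<in>plane. norm (of_real ((norm (fourier E \<xi>))\<^sup>2) * \<chi> (?s \<otimes> (\<xi> \<star> \<xi>))))"
    unfolding norm_transform_def by (rule norm_sum)
  also have "\<dots> = (\<Sum>\<xi>\<in>plane. (norm (fourier E \<xi>))\<^sup>2)"
  proof (rule sum.cong[OF refl])
    fix \<xi> assume "\<xi> \<in> plane"
    then have "?s \<otimes> (\<xi> \<star> \<xi>) \<in> carrier R" using s by simp
    then show "norm (of_real ((norm (fourier E \<xi>))\<^sup>2) * \<chi> (?s \<otimes> (\<xi> \<star> \<xi>))) = (norm (fourier E \<xi>))\<^sup>2"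
      by (simp add: norm_mult norm_power)
  qed
  also have "\<dots> = q * (q * card E)" using plancherel[OF E] by (simp add: power2_eq_square)
  finally show ?thesis using q_pos by simp
qed

text \<open>Plancherel in \<open>s\<close> pairs each point with all points on its own circle. Each
  circle mass is at most the root of the energy bound, and the remaining factor sums to q^2
  |E|.\<close>

lemma sum_norm_transform_bound:
  assumes E: "E \<subseteq> plane"
  shows "(\<Sum>s\<in>carrier R. (norm (norm_transform E s))\<^sup>2) \<le> q ^ 3 * card E * sqrt (3 * q\<^sup>2 * (card E) ^ 3)"
proof -
  define m where "m \<xi> = (norm (fourier E \<xi>))\<^sup>2" for \<xi>
  define B where "B = sqrt (3 * q\<^sup>2 * (card E) ^ 3)"
  have m_nonneg: "0 \<le> m \<xi>" for \<xi> unfolding m_def by simp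
  have "complex_of_real (\<Sum>s\<in>carrier R. (norm (\<Sum>\<xi>\<in>plane. of_real (m \<xi>) * \<chi> (s \<otimes> (\<xi> \<star> \<xi>))))\<^sup>2)
      = of_real q * (\<Sum>\<xi>\<in>plane. \<Sum>\<eta>\<in>{\<eta>\<in>plane. \<eta> \<star> \<eta> = \<xi> \<star> \<xi>}. of_real (m \<xi>) * cnj (of_real (m \<eta>)))"
    by (rule plancherel_general[OF finite_plane]) (rule orthogonality_line; simp)
  also have "\<dots> = of_real (q * (\<Sum>\<xi>\<in>plane. m \<xi> * (\<Sum>\<eta>\<in>{\<eta>\<in>plane. \<eta> \<star> \<eta> = \<xi> \<star> \<xi>}. m \<eta>)))"
    by (simp add: sum_distrib_left)
  finally have "(\<Sum>s\<in>carrier R. (norm (norm_transform E s))\<^sup>2) =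
      q * (\<Sum>\<xi>\<in>plane. m \<xi> * (\<Sum>\<eta>\<in>{\<eta>\<in>plane. \<eta> \<star> \<eta> = \<xi> \<star> \<xi>}. m \<eta>))"
    unfolding norm_transform_def m_def by (simp only: of_real_eq_iff)
  also have "\<dots> \<le> q * (\<Sum>\<xi>\<in>plane. m \<xi> * B)"
  proof (intro mult_left_mono sum_mono m_nonneg)
    fix \<xi>
    show "(\<Sum>\<eta>\<in>{\<eta>\<in>plane. \<eta> \<star> \<eta> = \<xi> \<star> \<xi>}. m \<eta>) \<le> B"
      unfolding B_def m_def by (rule real_le_rsqrt[OF circle_energy_bound[OF E]])
  qed simp
  also have "\<dots> = q ^ 3 * card E * B"
    unfolding sum_distrib_right[symmetric] m_def plancherel[OF E]
    by (simp add: power2_eq_square power3_eq_cube)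
  finally show ?thesis unfolding B_def .
qed

text \<open>The substitution s = 1/(4t) is injective on nonzero elements, so this sum is part of the
  previous one divided by q^2.\<close>

lemma sum_dist_transform_bound:
  assumes E: "E \<subseteq> plane"
  shows "(\<Sum>t\<in>carrier R - {\<zero>}. (norm (dist_transform E t))\<^sup>2) \<le> q * card E * sqrt (3 * q\<^sup>2 * (card E) ^ 3)"
proof -
  let ?T = "carrier R - {\<zero>}" and ?f = "\<lambda>t. inv ((t \<oplus> t) \<oplus> (t \<oplus> t))"
  have inj: "inj_on ?f ?T"
  proof (rule inj_onI)
    fix t u assume tu: "t \<in> ?T" "u \<in> ?T" "?f t = ?f u"
    then have eq: "(t \<oplus> t) \<oplus> (t \<oplus> t) = (u \<oplus> u) \<oplus> (u \<oplus> u)"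
      using four_unit by (metis DiffD1 DiffD2 Units_inv_inv insertI1)
    have mem: "t \<in> carrier R" "u \<in> carrier R" using tu by auto
    have "((t \<ominus> u) \<oplus> (t \<ominus> u)) \<oplus> ((t \<ominus> u) \<oplus> (t \<ominus> u)) = ((t \<oplus> t) \<oplus> (t \<oplus> t)) \<ominus> ((u \<oplus> u) \<oplus> (u \<oplus> u))"
      using mem by algebra
    also have "\<dots> = \<zero>" unfolding eq using mem by simp
    finally have "t \<ominus> u = \<zero>" using four_unit[of "t \<ominus> u"] mem field_Units by (metis DiffD2 insertI1 minus_closed)
    then show "t = u" using mem by simp
  qed
  have "q\<^sup>2 * (\<Sum>t\<in>?T. (norm (dist_transform E t))\<^sup>2) = (\<Sum>t\<in>?T. (norm (norm_transform E (?f t)))\<^sup>2)"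
    unfolding sum_distrib_left
    by (intro sum.cong refl) (simp add: norm_transform_eq[OF E] power_mult_distrib)
  also have "\<dots> = (\<Sum>s\<in>?f ` ?T. (norm (norm_transform E s))\<^sup>2)"
    by (simp add: sum.reindex[OF inj])
  also have "\<dots> \<le> (\<Sum>s\<in>carrier R. (norm (norm_transform E s))\<^sup>2)"
    using four_unit by (intro sum_mono2) auto
  also have "\<dots> \<le> q\<^sup>2 * (q * card E * sqrt (3 * q\<^sup>2 * (card E) ^ 3))"
    using sum_norm_transform_bound[OF E] by (simp add: power2_eq_square power3_eq_cube mult_ac)
  finally show ?thesis by (rule mult_left_le_imp_le) (rule zero_less_power[OF q_pos])
qed

section \<open>Counting the elements that are not sums of two distances\<close>

lemma missing_sums_bound:
  assumes E: "E \<subseteq> plane"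
  defines "B \<equiv> carrier R - (distance_set R E <+>\<^bsub>R\<^esub> distance_set R E)"
  shows "card B * real (card E) ^ 8 \<le> q ^ 4 * card E ^ 3 * sqrt (3 * q\<^sup>2 * (card E) ^ 3)"
proof -
  let ?\<nu> = "dist_transform E" and ?T = "carrier R - {\<zero>}"
  define d where "d p = (fst p \<boxminus> snd p) \<star> (fst p \<boxminus> snd p)" for p
  \<comment> \<open>The part with nonzero \<open>s\<close> of the character sum detecting
    representations of \<open>b\<close>, conjugated so that it is a Fourier series in
    \<open>b\<close> to which Plancherel applies.\<close>
  define F where "F b = (\<Sum>s\<in>?T. cnj ((?\<nu> s)\<^sup>2) * \<chi> (b \<otimes> s))" for b
  have d_in: "d p \<in> carrier R" if "p \<in> E \<times> E" for p
    using that E unfolding d_def by (intro vec_closed) auto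
  have \<nu>_eq: "?\<nu> s = (\<Sum>p\<in>E \<times> E. \<chi> (s \<otimes> d p))" for s
    unfolding dist_transform_def sum.cartesian_product d_def by (intro sum.cong refl) auto
  have d_dist: "d p \<in> distance_set R E" if "p \<in> E \<times> E" for p
  proof -
    have P: "fst p \<in> E" "snd p \<in> E" using that by auto
    then have "d p = sq_dist R (fst p) (snd p)" using sq_dist_eq E unfolding d_def by (metis subsetD)
    then show ?thesis unfolding distance_set_def using P by blast
  qed
  have norm_F: "norm (F b) = real (card E) ^ 4" if b: "b \<in> B" for b
  proof -
    have b_in: "b \<in> carrier R" using b unfolding B_def by blast
    have b_ne: "d p \<oplus> d p' \<noteq> b" if "p \<in> E \<times> E" "p' \<in> E \<times> E" for p p'
      using b d_dist[OF that(1)] d_dist[OF that(2)] unfolding B_def set_add_def' by blast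
    \<comment> \<open>Once the square is expanded, orthogonality in \<open>s\<close> counts the ways
      to write \<open>b\<close> as \<open>d p \<oplus> d p'\<close>, of which there are
      none.\<close>
    have "(\<Sum>s\<in>carrier R. (?\<nu> s)\<^sup>2 * cnj (\<chi> (s \<otimes> b))) =
        (\<Sum>s\<in>carrier R. \<Sum>p\<in>E \<times> E. \<Sum>p'\<in>E \<times> E. \<chi> (s \<otimes> (d p \<oplus> d p')) * cnj (\<chi> (s \<otimes> b)))"
    proof (rule sum.cong[OF refl])
      fix s assume s: "s \<in> carrier R"
      have "(?\<nu> s)\<^sup>2 = (\<Sum>p\<in>E \<times> E. \<Sum>p'\<in>E \<times> E. \<chi> (s \<otimes> d p) * \<chi> (s \<otimes> d p'))"
        unfolding \<nu>_eq power2_eq_square sum_product ..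
      also have "\<dots> = (\<Sum>p\<in>E \<times> E. \<Sum>p'\<in>E \<times> E. \<chi> (s \<otimes> (d p \<oplus> d p')))"
        using s d_in by (intro sum.cong refl) (simp add: r_distr \<chi>_add)
      finally show "(?\<nu> s)\<^sup>2 * cnj (\<chi> (s \<otimes> b)) =
          (\<Sum>p\<in>E \<times> E. \<Sum>p'\<in>E \<times> E. \<chi> (s \<otimes> (d p \<oplus> d p')) * cnj (\<chi> (s \<otimes> b)))"
        by (simp only: sum_distrib_right)
    qed
    also have "\<dots> = (\<Sum>p\<in>E \<times> E. \<Sum>s\<in>carrier R. \<Sum>p'\<in>E \<times> E. \<chi> (s \<otimes> (d p \<oplus> d p')) * cnj (\<chi> (s \<otimes> b)))"
      by (rule sum.swap)
    also have "\<dots> = (\<Sum>p\<in>E \<times> E. \<Sum>p'\<in>E \<times> E. \<Sum>s\<in>carrier R. \<chi> (s \<otimes> (d p \<oplus> d p')) * cnj (\<chi> (s \<otimes> b)))"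
      by (intro sum.cong[OF refl] sum.swap)
    also have "\<dots> = 0"
    proof (rule sum.neutral, rule ballI, rule sum.neutral, rule ballI)
      fix p p' assume p: "p \<in> E \<times> E" "p' \<in> E \<times> E"
      show "(\<Sum>s\<in>carrier R. \<chi> (s \<otimes> (d p \<oplus> d p')) * cnj (\<chi> (s \<otimes> b))) = 0"
        using orthogonality_line[of "d p \<oplus> d p'" b] b_ne[OF p] b_in d_in p by simp
    qed
    \<comment> \<open>Splitting off \<open>s\<close> = 0, whose term is |E|^4, determines the rest
      exactly.\<close>
    finally have "(?\<nu> \<zero>)\<^sup>2 * cnj (\<chi> (\<zero> \<otimes> b)) + (\<Sum>s\<in>?T. (?\<nu> s)\<^sup>2 * cnj (\<chi> (s \<otimes> b))) = 0"
      using sum.remove[OF finite_carrier zero_closed, of "\<lambda>s. (?\<nu> s)\<^sup>2 * cnj (\<chi> (s \<otimes> b))"] by metis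
    moreover have "?\<nu> \<zero> = of_nat (card E * card E)"
      unfolding \<nu>_eq using d_in by (simp add: card_cartesian_product)
    moreover have "(\<Sum>s\<in>?T. (?\<nu> s)\<^sup>2 * cnj (\<chi> (s \<otimes> b))) = cnj (F b)"
      unfolding F_def cnj_sum using b_in by (intro sum.cong refl) (simp add: m_comm)
    ultimately have "cnj (F b) = - of_nat (card E ^ 4)"
      using b_in by (simp add: power2_eq_square power4_eq_xxxx mult_ac eq_neg_iff_add_eq_0 add.commute)
    then have "norm (cnj (F b)) = norm (complex_of_nat (card E ^ 4))" by (simp only: norm_minus_cancel)
    then show ?thesis by (simp only: complex_mod_cnj norm_of_nat) simp
  qed
  have "complex_of_real (\<Sum>b\<in>carrier R. (norm (F b))\<^sup>2)
      = of_real q * (\<Sum>s\<in>?T. \<Sum>s'\<in>{s'\<in>?T. s' = s}. cnj ((?\<nu> s)\<^sup>2) * cnj (cnj ((?\<nu> s')\<^sup>2)))"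
    unfolding F_def by (rule plancherel_general) (use orthogonality_line in auto)
  also have "\<dots> = of_real q * (\<Sum>s\<in>?T. of_real ((norm (?\<nu> s)) ^ 4))"
  proof (intro arg_cong2[of _ _ _ _ "(*)"] sum.cong refl)
    fix s assume "s \<in> ?T"
    then have "{s'\<in>?T. s' = s} = {s}" by auto
    then have "(\<Sum>s'\<in>{s'\<in>?T. s' = s}. cnj ((?\<nu> s)\<^sup>2) * cnj (cnj ((?\<nu> s')\<^sup>2))) = (?\<nu> s)\<^sup>2 * cnj ((?\<nu> s)\<^sup>2)"
      by simp
    also have "\<dots> = of_real ((norm ((?\<nu> s)\<^sup>2))\<^sup>2)" by (rule complex_norm_square[symmetric])
    also have "(norm ((?\<nu> s)\<^sup>2))\<^sup>2 = (norm (?\<nu> s)) ^ 4" by (simp add: norm_power flip: power_mult)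
    finally show "(\<Sum>s'\<in>{s'\<in>?T. s' = s}. cnj ((?\<nu> s)\<^sup>2) * cnj (cnj ((?\<nu> s')\<^sup>2))) = of_real ((norm (?\<nu> s)) ^ 4)" .
  qed
  also have "\<dots> = of_real (q * (\<Sum>s\<in>?T. (norm (?\<nu> s)) ^ 4))" by simp
  finally have sum_F: "(\<Sum>b\<in>carrier R. (norm (F b))\<^sup>2) = q * (\<Sum>s\<in>?T. (norm (?\<nu> s)) ^ 4)"
    by (simp only: of_real_eq_iff)
  have "card B * real (card E) ^ 8 = (\<Sum>b\<in>B. (norm (F b))\<^sup>2)"
    by (simp add: norm_F flip: power_mult)
  also have "\<dots> \<le> (\<Sum>b\<in>carrier R. (norm (F b))\<^sup>2)"
    unfolding B_def by (intro sum_mono2) auto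
  also have "\<dots> = q * (\<Sum>s\<in>?T. (norm (?\<nu> s)) ^ 4)" by (rule sum_F)
  \<comment> \<open>Of the four factors, two are bounded pointwise and two are kept for the second
    moment.\<close>
  also have "\<dots> \<le> q * (\<Sum>s\<in>?T. (q * card E)\<^sup>2 * (norm (?\<nu> s))\<^sup>2)"
  proof (intro mult_left_mono sum_mono)
    fix s assume "s \<in> ?T"
    then have "norm (?\<nu> s) \<le> q * card E" using dist_transform_bound[OF E] by auto
    then have "(norm (?\<nu> s))\<^sup>2 \<le> (q * card E)\<^sup>2" by (intro power_mono) auto
    then have "(norm (?\<nu> s))\<^sup>2 * (norm (?\<nu> s))\<^sup>2 \<le> (q * card E)\<^sup>2 * (norm (?\<nu> s))\<^sup>2"
      by (rule mult_right_mono) simp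
    then show "(norm (?\<nu> s)) ^ 4 \<le> (q * card E)\<^sup>2 * (norm (?\<nu> s))\<^sup>2"
      by (simp flip: power_add)
  qed simp
  also have "\<dots> = q * (q * card E)\<^sup>2 * (\<Sum>s\<in>?T. (norm (?\<nu> s))\<^sup>2)"
    by (simp only: sum_distrib_left mult.assoc)
  also have "\<dots> \<le> q * (q * card E)\<^sup>2 * (q * card E * sqrt (3 * q\<^sup>2 * (card E) ^ 3))"
    by (rule mult_left_mono[OF sum_dist_transform_bound[OF E]]) simp
  also have "\<dots> = q ^ 4 * card E ^ 3 * sqrt (3 * q\<^sup>2 * (card E) ^ 3)"
    by (simp add: power2_eq_square power3_eq_cube power4_eq_xxxx mult_ac)
  finally show ?thesis .
qed

end

section \<open>Finite fields of order 3 modulo 4\<close>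

context field
begin

text \<open>By Lagrange's theorem in the additive group, \<open>a\<close> is annihilated by the odd
  order 2k + 1 as well as by 2, hence by 1.\<close>

lemma double_eq_zero_of_odd_card:
  assumes fin: "finite (carrier R)" and odd: "odd (card (carrier R))"
    and a: "a \<in> carrier R" "a \<oplus> a = \<zero>"
  shows "a = \<zero>"
proof -
  obtain k where k: "card (carrier R) = 2 * k + 1" using odd oddE by blast
  have "[card (carrier R)] \<cdot> a = \<zero>"
    using add.pow_order_eq_1[of a] fin a unfolding order_def by simp
  moreover have "[(2::nat)] \<cdot> a = \<zero>" using a by (simp add: numeral_2_eq_2 add.nat_pow_Suc)
  then have "[(2 * k)] \<cdot> a = \<zero>" using a by (simp add: add.nat_pow_pow[symmetric])
  ultimately show ?thesis using a unfolding k by simp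
qed

text \<open>Otherwise i = b/a has square -1. The multiplicative group has order 4k + 2, so 1 =
  i^(4k+2) = (-1)^(2k+1) = -1, against odd characteristic.\<close>

lemma sum_squares_eq_zero_of_card_3_mod_4:
  assumes fin: "finite (carrier R)" and card: "card (carrier R) mod 4 = 3"
    and ab: "a \<in> carrier R" "b \<in> carrier R" and eq: "a \<otimes> a \<oplus> b \<otimes> b = \<zero>"
  shows "a = \<zero>"
proof (rule ccontr)
  assume "a \<noteq> \<zero>"
  then have u: "a \<in> Units R" using ab by (simp add: field_Units)
  define i where "i = inv a \<otimes> b"
  have i: "i \<in> carrier R" unfolding i_def using u ab by simp
  have "\<one> \<oplus> i \<otimes> i = (inv a \<otimes> inv a) \<otimes> (a \<otimes> a \<oplus> b \<otimes> b)"
  proof -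
    have ia: "inv a \<in> carrier R" using u by simp
    have "(inv a \<otimes> inv a) \<otimes> (a \<otimes> a \<oplus> b \<otimes> b) = (inv a \<otimes> a) \<otimes> (inv a \<otimes> a) \<oplus> (inv a \<otimes> b) \<otimes> (inv a \<otimes> b)"
      using ia ab by algebra
    then show ?thesis unfolding i_def using u by simp
  qed
  also have "\<dots> = \<zero>" unfolding eq using u by simp
  finally have ii: "\<one> \<oplus> i \<otimes> i = \<zero>" .
  then have i_sq: "i \<otimes> i = \<ominus> \<one>" using i by (metis add.inv_closed minus_equality a_comm m_closed one_closed)
  have "i \<noteq> \<zero>" using ii by auto
  obtain k where k: "card (carrier R) = 4 * k + 3" using card by (metis mod_mult_div_eq add.commute)
  let ?U = "units_of R"
  interpret U: group ?U by (rule units_group)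
  have carrU: "carrier ?U = carrier R - {\<zero>}" by (simp add: units_of_carrier field_Units)
  have "i [^]\<^bsub>?U\<^esub> order ?U = \<one>\<^bsub>?U\<^esub>"
    by (rule U.pow_order_eq_1) (use carrU i \<open>i \<noteq> \<zero>\<close> in simp)
  moreover have "order ?U = 4 * k + 2"
    unfolding order_def carrU using fin k by (simp add: card_Diff_singleton)
  moreover have "i \<in> Units R" using i \<open>i \<noteq> \<zero>\<close> by (simp add: field_Units)
  ultimately have "i [^] (4 * k + 2) = \<one>"
    by (metis units_of_pow units_of_one)
  moreover have "i [^] (2::nat) = \<ominus> \<one>" using i i_sq by (simp add: numeral_2_eq_2)
  then have "i [^] (4 * k + 2) = (\<ominus> \<one>) [^] (2 * k + 1)"
    using i nat_pow_pow[of i 2 "2 * k + 1"] by (simp add: algebra_simps)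
  moreover have "(\<ominus> \<one>) [^] (2 * k + 1) = \<ominus> \<one>"
  proof -
    have "(\<ominus> \<one>) [^] (2::nat) = \<one>" by (simp add: numeral_2_eq_2 l_minus r_minus)
    then have "(\<ominus> \<one>) [^] (2 * k) = \<one>" using nat_pow_pow[of "\<ominus> \<one>" 2 k] by simp
    then show ?thesis by simp
  qed
  ultimately have "\<one> \<oplus> \<one> = \<zero>" using r_neg[of \<one>] by simp
  moreover have "odd (card (carrier R))" unfolding k by simp
  ultimately have "\<one> = \<zero>" using double_eq_zero_of_odd_card fin by blast
  then show False by simp
qed

lemma fourier_plane_exists:
  assumes card: "card (carrier R) mod 4 = 3"
  obtains \<chi> where "fourier_plane R \<chi>"
proof -
  \<comment> \<open>An infinite carrier has cardinality 0 by convention, which is not 3 modulo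
    4.\<close>
  have fin: "finite (carrier R)" using card by (metis card.infinite mod_0 zero_neq_numeral)
  have nt: "carrier (add_monoid R) \<noteq> {\<one>\<^bsub>add_monoid R\<^esub>}" using one_zeroI by auto
  have fin': "finite (carrier (add_monoid R))" using fin by simp
  obtain \<chi> :: "'a \<Rightarrow> complex"
    where \<chi>: "\<forall>x\<in>carrier R. \<forall>y\<in>carrier R. \<chi> (x \<oplus> y) = \<chi> x * \<chi> y"
      "\<forall>x\<in>carrier R. norm (\<chi> x) = 1" "\<exists>x\<in>carrier R. \<chi> x \<noteq> 1"
    using comm_group.nontrivial_character_exists[OF a_comm_group fin' nt] by auto
  have odd: "odd (card (carrier R))" using card by presburger
  have "fourier_plane R \<chi>"
  proof unfold_locales
    show "a = \<zero>" if "a \<in> carrier R" "a \<oplus> a = \<zero>" for a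
      using double_eq_zero_of_odd_card[OF fin odd that] .
    show "a = \<zero>" if "a \<in> carrier R" "b \<in> carrier R" "a \<otimes> a \<oplus> b \<otimes> b = \<zero>" for a b
      using sum_squares_eq_zero_of_card_3_mod_4[OF fin card that] .
  qed (use fin \<chi> in simp_all)
  then show thesis by (rule that)
qed

text \<open>Frees the bound from the auxiliary character.\<close>

lemma missing_distance_sums_bound:
  assumes "card (carrier R) mod 4 = 3" and "E \<subseteq> carrier R \<times> carrier R"
  shows "card (carrier R - (distance_set R E <+>\<^bsub>R\<^esub> distance_set R E)) * real (card E) ^ 8
    \<le> card (carrier R) ^ 4 * card E ^ 3 * sqrt (3 * (card (carrier R))\<^sup>2 * (card E) ^ 3)"
proof -
  obtain \<chi> where "fourier_plane R \<chi>" using fourier_plane_exists assms by blast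
  then interpret fourier_plane R \<chi> .
  show ?thesis using missing_sums_bound[OF assms(2)] by simp
qed

end

section \<open>From the counting bound to the limit\<close>

lemma eventually_q_to_infinityI:
  assumes "\<And>q. q \<in> prime_powers_3_mod_4 \<Longrightarrow> P q"
  shows "eventually P q_to_infinity"
  unfolding q_to_infinity_def eventually_inf_principal using assms by simp

text \<open>With b missing elements and e = |E|, squaring the bound and cancelling e^9 gives b^2 e^7
  \<le> 3 q^10. Dividing by q^2 e^7 leaves 3 q^8 / e^7, the seventh power of q^(8/7) / e up to the
  factor 3: this is where the exponent 8/7 comes from.\<close>

lemma (in field) distance_sums_ratio_bounds:
  fixes E :: "('a \<times> 'a) set"
  defines "q \<equiv> real (card (carrier R))"
    and "\<rho> \<equiv> real (card (distance_set R E <+>\<^bsub>R\<^esub> distance_set R E)) / real (card (carrier R))"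
  assumes card: "card (carrier R) mod 4 = 3" and E: "E \<subseteq> carrier R \<times> carrier R" and pos: "card E > 0"
  shows "1 - sqrt (3 * (q powr (8 / 7) / card E) ^ 7) \<le> \<rho>" and "\<rho> \<le> 1"
proof -
  define S where "S = distance_set R E <+>\<^bsub>R\<^esub> distance_set R E"
  define b where "b = real (card (carrier R - S))"
  define e where "e = real (card E)"
  have fin: "finite (carrier R)" using card by (metis card.infinite mod_0 zero_neq_numeral)
  have q: "q > 0" unfolding q_def using card by (metis mod_0 neq0_conv of_nat_0_less_iff zero_neq_numeral)
  have e: "e > 0" unfolding e_def using pos by simp
  have S: "S \<subseteq> carrier R"
  proof -
    have "distance_set R E \<subseteq> carrier R"
      using E unfolding distance_set_def sq_dist_def by (auto simp: subset_iff)
    then show ?thesis unfolding S_def set_add_def' by blast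
  qed
  have S_card: "real (card S) = q - b"
    using card_Diff_subset[OF finite_subset[OF S fin] S] card_mono[OF fin S]
    unfolding q_def b_def by (simp add: of_nat_diff)
  have \<rho>: "\<rho> = 1 - b / q"
    using q unfolding \<rho>_def S_def[symmetric] S_card q_def[symmetric] by (simp add: diff_divide_distrib)
  have "(b * e ^ 8)\<^sup>2 \<le> (q ^ 4 * e ^ 3 * sqrt (3 * q\<^sup>2 * e ^ 3))\<^sup>2"
    using missing_distance_sums_bound[OF card E] unfolding b_def S_def q_def e_def
    by (intro power_mono) auto
  also have "\<dots> = (q ^ 4 * e ^ 3)\<^sup>2 * (3 * q\<^sup>2 * e ^ 3)"
    using q e by (simp add: power_mult_distrib)
  finally have "(b\<^sup>2 * e ^ 7) * e ^ 9 \<le> (3 * q ^ 8 * q\<^sup>2) * e ^ 9"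
    by (simp add: power_mult_distrib mult_ac flip: power_mult power_add)
  then have "b\<^sup>2 * e ^ 7 \<le> 3 * q ^ 8 * q\<^sup>2"
    by (rule mult_right_le_imp_le) (use e in simp)
  then have "(b / q)\<^sup>2 \<le> 3 * (q ^ 8 / e ^ 7)"
    using q e by (simp add: power_divide field_simps)
  also have "q ^ 8 / e ^ 7 = (q powr (8 / 7) / e) ^ 7"
  proof -
    have "(q powr (8 / 7)) ^ 7 = q powr real 8"
      using q by (simp add: powr_powr flip: powr_numeral)
    also have "\<dots> = q ^ 8" using q by (rule powr_realpow)
    finally show ?thesis by (simp add: power_divide)
  qed
  finally have "b / q \<le> sqrt (3 * (q powr (8 / 7) / e) ^ 7)" by (rule real_le_rsqrt)
  then show "1 - sqrt (3 * (q powr (8 / 7) / card E) ^ 7) \<le> \<rho>" unfolding \<rho> e_def by simp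
  show "\<rho> \<le> 1" unfolding \<rho> b_def using q by simp
qed

theorem corollary1p8:
  fixes F :: "nat \<Rightarrow> ('a, 'm) ring_scheme"
    and E :: "nat \<Rightarrow> ('a \<times> 'a) set"
  assumes "\<And>q. q \<in> prime_powers_3_mod_4 \<Longrightarrow> field (F q)"
    and "\<And>q. q \<in> prime_powers_3_mod_4 \<Longrightarrow> card (carrier (F q)) = q"
    and "\<And>q. q \<in> prime_powers_3_mod_4 \<Longrightarrow> E q \<subseteq> carrier (F q) \<times> carrier (F q)"
    and "(\<lambda>q. real q powr (8 / 7)) \<in> o[q_to_infinity](\<lambda>q. real (card (E q)))"
  shows "((\<lambda>q. real (card (distance_set (F q) (E q) <+>\<^bsub>F q\<^esub> distance_set (F q) (E q))) / real q)
            \<longlongrightarrow> 1) q_to_infinity"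
proof -
  define r where "r q = real q powr (8 / 7) / real (card (E q))" for q
  have mod4: "q mod 4 = 3" if "q \<in> prime_powers_3_mod_4" for q
    using that unfolding prime_powers_3_mod_4_def by simp
  \<comment> \<open>Little-o with constant 1 makes \<open>E q\<close> eventually nonempty. This
    matters because for empty \<open>E q\<close> the quotient \<open>r q\<close> is 0 by convention
    and the lower bound would fail.\<close>
  have "eventually (\<lambda>q. norm (real q powr (8 / 7)) \<le> 1 * norm (real (card (E q)))) q_to_infinity"
    by (rule landau_o.smallD[OF assms(4)]) simp
  moreover have "eventually (\<lambda>q. q \<in> prime_powers_3_mod_4) q_to_infinity"
    by (rule eventually_q_to_infinityI)
  ultimately have good: "eventually (\<lambda>q. q \<in> prime_powers_3_mod_4 \<and> card (E q) > 0) q_to_infinity"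
  proof eventually_elim
    case (elim q)
    then have "q > 0" using mod4[of q] by (cases q) auto
    then have "0 < real q powr (8 / 7)" by simp
    also have "\<dots> \<le> real (card (E q))" using elim(1) by simp
    finally show ?case using elim(2) by simp
  qed
  have "(r \<longlongrightarrow> 0) q_to_infinity"
    unfolding r_def by (rule smalloD_tendsto[OF assms(4)])
  then have "((\<lambda>q. 1 - sqrt (3 * r q ^ 7)) \<longlongrightarrow> 1 - sqrt (3 * 0 ^ 7)) q_to_infinity"
    by (intro tendsto_intros)
  then have lower: "((\<lambda>q. 1 - sqrt (3 * r q ^ 7)) \<longlongrightarrow> 1) q_to_infinity" by simp
  \<comment> \<open>The ratio is squeezed between 1 minus a vanishing error and 1.\<close>
  show ?thesis
  proof (rule tendsto_sandwich[OF _ _ lower tendsto_const])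
    show "\<forall>\<^sub>F q in q_to_infinity. 1 - sqrt (3 * r q ^ 7) \<le>
        real (card (distance_set (F q) (E q) <+>\<^bsub>F q\<^esub> distance_set (F q) (E q))) / real q"
      using good
    proof eventually_elim
      case (elim q)
      then show ?case
        using field.distance_sums_ratio_bounds(1)[OF assms(1), of q "E q"] assms(2,3)[of q] mod4[of q]
        unfolding r_def by simp
    qed
    show "\<forall>\<^sub>F q in q_to_infinity.
        real (card (distance_set (F q) (E q) <+>\<^bsub>F q\<^esub> distance_set (F q) (E q))) / real q \<le> 1"
      using good
    proof eventually_elim
      case (elim q)
      then show ?case
        using field.distance_sums_ratio_bounds(2)[OF assms(1), of q "E q"] assms(2,3)[of q] mod4[of q]
        by simp
    qed
  qed
qed

end
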